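(* Let $\sigma\in L^\infty(\mathbb{T})$ with $\sigma_{\min}:=\inf_{x\in\mathbb{T}}\sigma(x)>0$, and let $u_1,u_2,u_3\in C([0,\infty);L^2(\mathbb{T}))$ be mild real-valued solutions of $$\partial_tu_1(x,t)+\sqrt{\tfrac23}\,\partial_xu_2(x,t)=0,$$ $$\partial_tu_2(x,t)+\sqrt{\tfrac23}\,\partial_xu_1(x,t)+\tfrac1{\sqrt3}\,\partial_xu_3(x,t)=-\sigma(x)u_2(x,t),$$ $$\partial_tu_3(x,t)+\tfrac1{\sqrt3}\,\partial_xu_2(x,t)=-\sigma(x)u_3(x,t)$$ on $\mathbb{T}\times(0,\infty)$ with initial data $u_{1,0},u_{2,0},u_{3,0}\in L^2(\mathbb{T})$. Let $u_\infty=\frac{1}{2\pi}\int_0^{2\pi}u_{1,0}(x)\,dx$. Then $$\mathfrak{E}_\theta(u_1(t)-u_\infty,u_2(t),u_3(t))\le\mathfrak{E}_\theta(u_{1,0}-u_\infty,u_{2,0},u_{3,0})\,e^{-\alpha t},\qquad t\ge0,$$ for any $\theta>0$ and $\alpha>0$ such that $$\sqrt{\tfrac23}\,\theta+\alpha<2\sigma_{\min},\qquad \alpha\le\sqrt{\tfrac23}\,\theta,$$ and $$\left(\sup_{x\in\mathbb{T}}\frac{\theta^2(\sigma(x)-\alpha)^2}{8\sigma(x)-4\sqrt{\frac23}\,\theta-4\alpha}\right)+\left(\sup_{x\in\mathbb{T}}\frac{\theta^2}{12(2\sigma(x)-\alpha)}\right)\le\sqrt{\tfrac23}\,\theta-\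alpha.$$
   Context: $\mathbb{T}$ is the one-dimensional torus, i.e. $[0,2\pi]$ with periodic boundary conditions. $\|f\|^2=\frac1{2\pi}\int_0^{2\pi}|f(x)|^2dx$. The anti-derivative of $f$ is $\partial_x^{-1}f(x):=\int_0^xf(y)\,dy-\frac1{2\pi}\int_0^{2\pi}\Big(\int_0^zf(y)\,dy\Big)dz$. For real-valued $f,g,h\in L^2(\mathbb{T})$, $$\mathfrak{E}_\theta(f,g,h):=\|f\|^2+\|g\|^2+\|h\|^2-\frac{\theta}{2\pi}\int_0^{2\pi}\partial_x^{-1}f(x)\,g(x)\,dx.$$ The system is the 3-velocity Goldstein-Taylor model in macroscopic variables, where $u_1=\frac1{\sqrt3}(f_1+f_2+f_3)$ and hence $u_\infty=\frac{1}{2\sqrt3\,\pi}\int_{\mathbb{T}}(f_{1,0}+f_{2,0}+f_{3,0})\,dx$. Mild solution is meant in the sense of semigroup theory, for the $C_0$-semigroup on $L^2(\mathbb{T})^3$ generated by $A(u_1,u_2,u_3)=\big(-\sqrt{\frac23}\partial_xu_2,\,-\sqrt{\frac23}\partial_xu_1-\frac1{\sqrt3}\partial_xu_3-\sigma u_2,\,-\frac1{\sqrt3}\partial_xu_2-\sigma u_3\big)$ (with its natural maximal domain in $L^2(\mathbb{T})^3$). Infima and suprema over $x\in\mathbb{T}$ of expressions involving $\sigma$ are essential infima and suprema. *)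

theory Defs
  imports "HOL-Probability.Essential_Supremum"
begin

section \<open>The real Hilbert space of square-integrable functions on the torus\<close>

abbreviation torus :: "real measure"
  where "torus \<equiv> lebesgue_on {0..2 * pi}"

definition square_int :: "(real \<Rightarrow> real) \<Rightarrow> bool"
  where "square_int f \<longleftrightarrow> f \<in> borel_measurable torus \<and> integrable torus (\<lambda>x. (f x)\<^sup>2)"

definition L2_rel :: "(real \<Rightarrow> real) \<Rightarrow> (real \<Rightarrow> real) \<Rightarrow> bool"
  where "L2_rel f g \<longleftrightarrow> square_int f \<and> square_int g \<and> (AE x in torus. f x = g x)"

lemma square_int_zero: "square_int (\<lambda>x. 0)"
  by (simp add: square_int_def)

lemma square_int_mult:
  assumes "square_int f" "square_int g"
  shows "integrable torus (\<lambda>x. f x * g x)"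
proof (rule Bochner_Integration.integrable_bound)
  show "integrable torus (\<lambda>x. (f x)\<^sup>2 + (g x)\<^sup>2)"
    using assms by (auto simp: square_int_def)
  show "(\<lambda>x. f x * g x) \<in> borel_measurable torus"
    using assms by (auto simp: square_int_def)
  have "\<bar>a * b\<bar> \<le> a\<^sup>2 + b\<^sup>2" for a b :: real
  proof -
    have "0 \<le> (a + b)\<^sup>2" "0 \<le> (a - b)\<^sup>2" "0 \<le> a\<^sup>2" "0 \<le> b\<^sup>2" by simp_all
    then show ?thesis by (simp add: power2_eq_square algebra_simps abs_if)
  qed
  then show "AE x in torus. norm (f x * g x) \<le> norm ((f x)\<^sup>2 + (g x)\<^sup>2)"
    by simp
qed

lemma square_int_add:
  assumes "square_int f" "square_int g"
  shows "square_int (\<lambda>x. f x + g x)"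
  using assms square_int_mult[OF assms]
  by (auto simp: square_int_def power2_sum mult.assoc)

lemma square_int_scale:
  assumes "square_int f"
  shows "square_int (\<lambda>x. c * f x)"
  using assms by (auto simp: square_int_def power_mult_distrib)

lemma square_int_uminus: "square_int f \<Longrightarrow> square_int (\<lambda>x. - f x)"
  using square_int_scale[of f "- 1"] by simp

lemma square_int_diff: "square_int f \<Longrightarrow> square_int g \<Longrightarrow> square_int (\<lambda>x. f x - g x)"
  using square_int_add[OF _ square_int_uminus] by simp

quotient_type torus_L2 = "real \<Rightarrow> real" / partial: L2_rel
  morphisms rep_L2 to_L2
proof (rule part_equivpI)
  show "\<exists>f. L2_rel f f"
    using square_int_zero by (auto simp: L2_rel_def)
  show "symp L2_rel"
    by (auto simp: symp_def L2_rel_def)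
  show "transp L2_rel"
    by (auto simp: transp_def L2_rel_def elim: AE_mp)
qed

instantiation torus_L2 :: real_inner
begin

lift_definition zero_torus_L2 :: torus_L2 is "\<lambda>x. 0"
  by (simp add: L2_rel_def square_int_zero)

lift_definition plus_torus_L2 :: "torus_L2 \<Rightarrow> torus_L2 \<Rightarrow> torus_L2" is "\<lambda>f g x. f x + g x"
  by (auto simp: L2_rel_def square_int_add)

lift_definition scaleR_torus_L2 :: "real \<Rightarrow> torus_L2 \<Rightarrow> torus_L2" is "\<lambda>c f x. c * f x"
  by (auto simp: L2_rel_def square_int_scale)

lift_definition uminus_torus_L2 :: "torus_L2 \<Rightarrow> torus_L2" is "\<lambda>f x. - f x"
  by (auto simp: L2_rel_def square_int_uminus)

lift_definition minus_torus_L2 :: "torus_L2 \<Rightarrow> torus_L2 \<Rightarrow> torus_L2" is "\<lambda>f g x. f x - g x"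
  by (auto simp: L2_rel_def square_int_diff)

text \<open>The inner product is normalised by \<open>1 / (2\<pi>)\<close>.\<close>

lift_definition inner_torus_L2 :: "torus_L2 \<Rightarrow> torus_L2 \<Rightarrow> real"
  is "\<lambda>f g. (1 / (2 * pi)) * (LINT x|torus. f x * g x)"
  by (auto simp: L2_rel_def square_int_def intro!: integral_cong_AE)

definition norm_torus_L2 :: "torus_L2 \<Rightarrow> real"
  where "norm f = sqrt (inner f (f :: torus_L2))"

definition dist_torus_L2 :: "torus_L2 \<Rightarrow> torus_L2 \<Rightarrow> real"
  where "dist f g = norm (f - (g :: torus_L2))"

definition sgn_torus_L2 :: "torus_L2 \<Rightarrow> torus_L2"
  where "sgn f = inverse (norm f) *\<^sub>R (f :: torus_L2)"

definition uniformity_torus_L2 :: "(torus_L2 \<times> torus_L2) filter"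
  where "uniformity_torus_L2 = (INF e\<in>{0 <..}. principal {(x, y). dist x (y :: torus_L2) < e})"

definition open_torus_L2 :: "torus_L2 set \<Rightarrow> bool"
  where "open_torus_L2 U =
    (\<forall>x\<in>U. eventually (\<lambda>(x', y). x' = x \<longrightarrow> y \<in> U) (uniformity :: (torus_L2 \<times> torus_L2) filter))"

instance
proof
  fix f g h :: torus_L2 and a b :: real
  show "f + g + h = f + (g + h)"
    by transfer (auto simp: L2_rel_def square_int_add add.assoc)
  show "f + g = g + f"
    by transfer (auto simp: L2_rel_def square_int_add add.commute)
  show "0 + f = f"
    by transfer (auto simp: L2_rel_def)
  show "- f + f = 0"
    by transfer (auto simp: L2_rel_def square_int_zero)
  show "f - g = f + - g"
    by transfer (auto simp: L2_rel_def square_int_diff)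
  show "a *\<^sub>R (f + g) = a *\<^sub>R f + a *\<^sub>R g"
    by transfer (auto simp: L2_rel_def square_int_add square_int_scale distrib_left)
  show "(a + b) *\<^sub>R f = a *\<^sub>R f + b *\<^sub>R f"
    by transfer (auto simp: L2_rel_def square_int_add square_int_scale distrib_right)
  show "a *\<^sub>R b *\<^sub>R f = (a * b) *\<^sub>R f"
    by transfer (auto simp: L2_rel_def square_int_scale mult.assoc)
  show "1 *\<^sub>R f = f"
    by transfer (auto simp: L2_rel_def)
  show "dist f g = norm (f - g)"
    by (rule dist_torus_L2_def)
  show "sgn f = inverse (norm f) *\<^sub>R f"
    by (rule sgn_torus_L2_def)
  show "(uniformity :: (torus_L2 \<times> torus_L2) filter) = (INF e\<in>{0 <..}. principal {(x, y). dist x y < e})"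
    by (rule uniformity_torus_L2_def)
  show "open U \<longleftrightarrow> (\<forall>x\<in>U. \<forall>\<^sub>F (x', y) in uniformity. x' = x \<longrightarrow> y \<in> U)" for U :: "torus_L2 set"
    by (rule open_torus_L2_def)
  show "inner f g = inner g f"
    by transfer (simp add: mult.commute)
  show "inner (f + g) h = inner f h + inner g h"
    by transfer (auto simp: L2_rel_def distrib_right distrib_left square_int_mult)
  show "inner (a *\<^sub>R f) g = a * inner f g"
    by transfer (simp add: mult.assoc)
  show "0 \<le> inner f f"
    by transfer (auto simp: L2_rel_def intro!: mult_nonneg_nonneg integral_nonneg_AE)
  show "inner f f = 0 \<longleftrightarrow> f = 0"
    by transfer (auto simp: L2_rel_def square_int_def power2_eq_square integral_nonneg_eq_0_iff_AE)
  show "norm f = sqrt (inner f f)"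
    by (rule norm_torus_L2_def)
qed

end

text \<open>\<^const>\<open>to_L2\<close> is the class of a square-integrable function, \<^const>\<open>rep_L2\<close> picks a representative.\<close>

lemma square_int_rep_L2: "square_int (rep_L2 f)"
  using Quotient_rep_reflp[OF Quotient_torus_L2] by (auto simp: L2_rel_def)

lemma AE_rep_L2_to_L2:
  assumes "square_int f"
  shows "AE x in torus. rep_L2 (to_L2 f) x = f x"
  using rep_abs_rsp_left[OF Quotient3_torus_L2, of f f] assms
  by (auto simp: L2_rel_def)

lemma to_L2_rep_L2: "to_L2 (rep_L2 f) = f"
  by (rule Quotient_abs_rep[OF Quotient_torus_L2])

lemma inner_to_L2:
  assumes "square_int f" "square_int g"
  shows "inner (to_L2 f) (to_L2 g) = (1 / (2 * pi)) * (LINT x|torus. f x * g x)"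
  using assms by (subst inner_torus_L2.abs_eq) (auto simp: L2_rel_def)

lemma inner_torus_L2_rep:
  "inner f g = (1 / (2 * pi)) * (LINT x|torus. rep_L2 f x * rep_L2 g x)"
  using inner_to_L2[OF square_int_rep_L2 square_int_rep_L2, of f g] by (simp add: to_L2_rep_L2)

lemma norm_to_L2:
  assumes "square_int f"
  shows "(norm (to_L2 f))\<^sup>2 = (1 / (2 * pi)) * (LINT x|torus. (f x)\<^sup>2)"
  unfolding power2_norm_eq_inner inner_to_L2[OF assms assms] by (simp add: power2_eq_square)

lemma diff_to_L2:
  assumes "square_int f" "square_int g"
  shows "to_L2 f - to_L2 g = to_L2 (\<lambda>x. f x - g x)"
  using assms by (subst minus_torus_L2.abs_eq) (auto simp: L2_rel_def)

lemma nn_integral_square_to_L2: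
  assumes "square_int f"
  shows "(\<integral>\<^sup>+ x. ennreal ((f x)\<^sup>2) \<partial>torus) = ennreal (2 * pi * (norm (to_L2 f))\<^sup>2)"
  using assms by (subst nn_integral_eq_integral) (auto simp: square_int_def norm_to_L2)

instance torus_L2 :: banach
proof
  fix X :: "nat \<Rightarrow> torus_L2"
  assume X: "Cauchy X"
  have "\<exists>N. \<forall>m\<ge>N. \<forall>n\<ge>N. dist (X m) (X n) < (1 / 2) ^ k" for k :: nat
    using X by (auto simp: Cauchy_def)
  then obtain N where N: "\<And>k m n. m \<ge> N k \<Longrightarrow> n \<ge> N k \<Longrightarrow> dist (X m) (X n) < (1 / 2) ^ k"
    by metis
  define r where "r n = (\<Sum>i\<le>n. N i + 1)" for n
  have r: "strict_mono r"
    by (rule strict_mono_Suc_iff[THEN iffD2]) (auto simp: r_def)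
  have rN: "r n \<ge> N n" for n
    by (cases n) (auto simp: r_def)
  have close: "dist (X (r m)) (X (r n)) < (1 / 2) ^ k" if "m \<ge> k" "n \<ge> k" for m n k
    using that rN[of k] r by (intro N) (auto intro: order_trans[OF _ strict_mono_leD])
  define f where "f n = rep_L2 (X (r n))" for n
  have f_sq: "square_int (f n)" for n
    by (simp add: f_def square_int_rep_L2)
  then have f_meas[measurable]: "f n \<in> borel_measurable torus" for n
    by (simp add: square_int_def)
  have to_f: "to_L2 (f n) = X (r n)" for n
    by (simp add: f_def to_L2_rep_L2)
  have diff: "(\<integral>\<^sup>+ x. ennreal ((f m x - f n x)\<^sup>2) \<partial>torus) = ennreal (2 * pi * (dist (X (r m)) (X (r n)))\<^sup>2)"
    for m n
    using nn_integral_square_to_L2[OF square_int_diff[OF f_sq f_sq], of m n]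
    by (simp add: diff_to_L2[OF f_sq f_sq, symmetric] to_f dist_norm)
  have emeasure_torus: "emeasure torus (space torus) = ennreal (2 * pi)"
    by (simp add: emeasure_restrict_space)
  have step: "(\<integral>\<^sup>+ x. ennreal \<bar>f (Suc n) x - f n x\<bar> \<partial>torus) \<le> ennreal (4 * pi * (1 / 2) ^ n)" for n
  proof -
    have bound: "\<bar>d\<bar> \<le> 2 ^ n * d\<^sup>2 + (1 / 2) ^ n" for d :: real
    proof -
      have "y \<le> y\<^sup>2 + 1" for y :: real
        using zero_le_power2[of "y - 1 / 2"] by (simp add: power2_eq_square algebra_simps)
      from this[of "2 ^ n * \<bar>d\<bar>"]
      have "2 ^ n * \<bar>d\<bar> \<le> 2 ^ n * (2 ^ n * d\<^sup>2 + (1 / 2) ^ n)"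
        by (simp add: power_mult_distrib power2_eq_square algebra_simps power_divide)
      then show ?thesis
        by (subst (asm) mult_le_cancel_left_pos) auto
    qed
    have "(\<integral>\<^sup>+ x. ennreal \<bar>f (Suc n) x - f n x\<bar> \<partial>torus)
      \<le> (\<integral>\<^sup>+ x. ennreal (2 ^ n) * ennreal ((f (Suc n) x - f n x)\<^sup>2) + ennreal ((1 / 2) ^ n) \<partial>torus)"
      using bound by (intro nn_integral_mono) (simp flip: ennreal_plus ennreal_mult' add: ennreal_leI)
    also have "\<dots> = ennreal (2 ^ n) * ennreal (2 * pi * (dist (X (r (Suc n))) (X (r n)))\<^sup>2)
        + ennreal ((1 / 2) ^ n) * ennreal (2 * pi)"
      by (subst nn_integral_add) (auto simp: nn_integral_cmult diff emeasure_torus[simplified])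
    also have "\<dots> = ennreal (2 ^ n * (2 * pi * (dist (X (r (Suc n))) (X (r n)))\<^sup>2) + (1 / 2) ^ n * (2 * pi))"
      by (simp add: ennreal_plus ennreal_mult)
    also have "\<dots> \<le> ennreal (4 * pi * (1 / 2) ^ n)"
    proof (rule ennreal_leI)
      have "(dist (X (r (Suc n))) (X (r n)))\<^sup>2 \<le> ((1 / 2) ^ n)\<^sup>2"
        using close[of n "Suc n" n] by (intro power_mono) auto
      then have "2 ^ n * (2 * pi * (dist (X (r (Suc n))) (X (r n)))\<^sup>2) \<le> 2 ^ n * (2 * pi * ((1 / 2) ^ n)\<^sup>2)"
        by (intro mult_left_mono) auto
      also have "\<dots> = 2 * pi * (1 / 2) ^ n"
        by (simp add: power2_eq_square power_divide)
      finally show "2 ^ n * (2 * pi * (dist (X (r (Suc n))) (X (r n)))\<^sup>2) + (1 / 2) ^ n * (2 * pi)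
          \<le> 4 * pi * (1 / 2) ^ n"
        by simp
    qed
    finally show ?thesis .
  qed
  have "(\<integral>\<^sup>+ x. (\<Sum>n. ennreal \<bar>f (Suc n) x - f n x\<bar>) \<partial>torus)
      = (\<Sum>n. \<integral>\<^sup>+ x. ennreal \<bar>f (Suc n) x - f n x\<bar> \<partial>torus)"
    by (rule nn_integral_suminf) measurable
  also have "\<dots> \<le> (\<Sum>n. ennreal (4 * pi * (1 / 2) ^ n))"
    by (intro suminf_le step) auto
  also have "\<dots> = ennreal (\<Sum>n. 4 * pi * (1 / 2) ^ n)"
    by (intro suminf_ennreal2 summable_mult summable_geometric) auto
  finally have "(\<integral>\<^sup>+ x. (\<Sum>n. ennreal \<bar>f (Suc n) x - f n x\<bar>) \<partial>torus) \<noteq> \<infinity>"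
    by (auto simp: top_unique)
  then have "AE x in torus. (\<Sum>n. ennreal \<bar>f (Suc n) x - f n x\<bar>) \<noteq> \<infinity>"
    by (intro nn_integral_noteq_infinite) measurable
  then have conv: "AE x in torus. (\<lambda>n. f n x) \<longlonglongrightarrow> lim (\<lambda>n. f n x)"
  proof (rule AE_mp, intro AE_I2 impI)
    fix x assume "(\<Sum>n. ennreal \<bar>f (Suc n) x - f n x\<bar>) \<noteq> \<infinity>"
    then have "summable (\<lambda>n. \<bar>f (Suc n) x - f n x\<bar>)"
      by (intro summable_suminf_not_top) auto
    then have "summable (\<lambda>n. f (Suc n) x - f n x)"
      by (rule summable_rabs_cancel)
    then have "convergent (\<lambda>n. \<Sum>i<n. f (Suc i) x - f i x)"
      by (simp add: summable_iff_convergent)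
    then have "convergent (\<lambda>n. (f n x - f 0 x) + f 0 x)"
      by (intro convergent_add convergent_const) (simp add: sum_lessThan_telescope[of "\<lambda>i. f i x"])
    then show "(\<lambda>n. f n x) \<longlonglongrightarrow> lim (\<lambda>n. f n x)"
      by (simp add: convergent_LIMSEQ_iff)
  qed
  define g where "g x = lim (\<lambda>n. f n x)" for x
  have g_meas[measurable]: "g \<in> borel_measurable torus"
    unfolding g_def by measurable
  have Fatou: "(\<integral>\<^sup>+ x. ennreal ((f n x - g x)\<^sup>2) \<partial>torus) \<le> ennreal (2 * pi * ((1 / 2) ^ n)\<^sup>2)" for n
  proof -
    have "(\<integral>\<^sup>+ x. ennreal ((f n x - g x)\<^sup>2) \<partial>torus)
        = (\<integral>\<^sup>+ x. liminf (\<lambda>m. ennreal ((f n x - f m x)\<^sup>2)) \<partial>torus)"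
    proof (rule nn_integral_cong_AE, use conv in \<open>rule AE_mp\<close>, intro AE_I2 impI)
      fix x assume "(\<lambda>m. f m x) \<longlonglongrightarrow> lim (\<lambda>m. f m x)"
      then have "(\<lambda>m. ennreal ((f n x - f m x)\<^sup>2)) \<longlonglongrightarrow> ennreal ((f n x - g x)\<^sup>2)"
        unfolding g_def by (intro tendsto_intros)
      then show "ennreal ((f n x - g x)\<^sup>2) = liminf (\<lambda>m. ennreal ((f n x - f m x)\<^sup>2))"
        by (rule lim_imp_Liminf[symmetric, rotated]) simp
    qed
    also have "\<dots> \<le> liminf (\<lambda>m. \<integral>\<^sup>+ x. ennreal ((f n x - f m x)\<^sup>2) \<partial>torus)"
      by (rule nn_integral_liminf) measurable
    also have "\<dots> \<le> liminf (\<lambda>m. ennreal (2 * pi * ((1 / 2) ^ n)\<^sup>2))"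
    proof (rule Liminf_mono)
      show "\<forall>\<^sub>F m in sequentially. (\<integral>\<^sup>+ x. ennreal ((f n x - f m x)\<^sup>2) \<partial>torus)
          \<le> ennreal (2 * pi * ((1 / 2) ^ n)\<^sup>2)"
        using eventually_ge_at_top[of n]
      proof eventually_elim
        case (elim m)
        have "(dist (X (r n)) (X (r m)))\<^sup>2 \<le> ((1 / 2) ^ n)\<^sup>2"
          using close[of n n m] elim by (intro power_mono) auto
        then show ?case
          unfolding diff by (intro ennreal_leI mult_left_mono) auto
      qed
    qed
    also have "\<dots> = ennreal (2 * pi * ((1 / 2) ^ n)\<^sup>2)"
      by (simp add: Liminf_const)
    finally show ?thesis .
  qed
  have fg_sq: "square_int (\<lambda>x. f n x - g x)" for n
    unfolding square_int_def
  proof (intro conjI integrableI_nonneg)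
    show "(\<integral>\<^sup>+ x. ennreal ((f n x - g x)\<^sup>2) \<partial>torus) < \<infinity>"
      using Fatou[of n] by (auto intro: le_less_trans)
  qed auto
  have g_sq: "square_int g"
    using square_int_diff[OF f_sq fg_sq, of 0 0] by simp
  have lim: "norm (X (r n) - to_L2 g) \<le> (1 / 2) ^ n" for n
  proof -
    have "ennreal (2 * pi * (norm (X (r n) - to_L2 g))\<^sup>2) \<le> ennreal (2 * pi * ((1 / 2) ^ n)\<^sup>2)"
      using Fatou[of n] nn_integral_square_to_L2[OF fg_sq, of n]
      by (simp add: diff_to_L2[OF f_sq g_sq, symmetric] to_f)
    then have "(norm (X (r n) - to_L2 g))\<^sup>2 \<le> ((1 / 2) ^ n)\<^sup>2"
      by (subst (asm) ennreal_le_iff) auto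
    then show ?thesis
      by (rule power2_le_imp_le) simp
  qed
  have "(\<lambda>n. X (r n) - to_L2 g) \<longlonglongrightarrow> 0"
    by (rule Lim_null_comparison[of _ "\<lambda>n. (1 / 2) ^ n"]) (auto simp: lim intro!: LIMSEQ_power_zero)
  then have "(X \<circ> r) \<longlonglongrightarrow> to_L2 g"
    by (simp add: o_def LIM_zero_iff)
  then show "convergent X"
    using X r by (blast intro: convergentI Cauchy_converges_subseq)
qed

section \<open>Semigroups\<close>

definition C0_semigroup :: "(real \<Rightarrow> 'a \<Rightarrow> 'a :: banach) \<Rightarrow> bool"
  where "C0_semigroup T \<longleftrightarrow>
    (\<forall>t\<ge>0. bounded_linear (T t)) \<and>
    (\<forall>x. T 0 x = x) \<and>
    (\<forall>s\<ge>0. \<forall>t\<ge>0. \<forall>x. T (s + t) x = T s (T t x)) \<and>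
    (\<forall>x. ((\<lambda>t. T t x) \<longlongrightarrow> x) (at_right 0))"

text \<open>Unbounded operators are represented by their graphs.\<close>

definition generator :: "(real \<Rightarrow> 'a \<Rightarrow> 'a :: banach) \<Rightarrow> ('a \<times> 'a) set"
  where "generator T = {(x, y). ((\<lambda>h. (1 / h) *\<^sub>R (T h x - x)) \<longlongrightarrow> y) (at_right 0)}"

definition mild_solution :: "('a \<times> 'a) set \<Rightarrow> 'a \<Rightarrow> (real \<Rightarrow> 'a :: banach) \<Rightarrow> bool"
  where "mild_solution A u0 u \<longleftrightarrow>
    (\<exists>T. C0_semigroup T \<and> generator T = A \<and> (\<forall>t\<ge>0. u t = T t u0))"

section \<open>The Goldstein-Taylor operator\<close>

definition test_function :: "(real \<Rightarrow> real) \<Rightarrow> bool"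
  where "test_function \<phi> \<longleftrightarrow>
    (\<forall>n x. (deriv ^^ n) \<phi> field_differentiable at x) \<and> (\<forall>x. \<phi> (x + 2 * pi) = \<phi> x)"

text \<open>\<open>weak_deriv f g\<close>: the distributional derivative of \<open>f\<close> on the torus is \<open>g\<close>.
  The test functions are periodic, so a jump between \<open>0\<close> and \<open>2\<pi>\<close> is not allowed.\<close>

definition weak_deriv :: "torus_L2 \<Rightarrow> torus_L2 \<Rightarrow> bool"
  where "weak_deriv f g \<longleftrightarrow>
    (\<forall>\<phi>. test_function \<phi> \<longrightarrow>
      (LINT x|torus. rep_L2 f x * deriv \<phi> x) = - (LINT x|torus. rep_L2 g x * \<phi> x))"

definition mult_L2 :: "(real \<Rightarrow> real) \<Rightarrow> torus_L2 \<Rightarrow> torus_L2"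
  where "mult_L2 \<sigma> f = to_L2 (\<lambda>x. \<sigma> x * rep_L2 f x)"

text \<open>The graph consists of the pairs \<open>(u, v)\<close> with
  \<open>v\<^sub>1 = - sqrt (2/3) u\<^sub>2'\<close>, \<open>v\<^sub>2 = - sqrt (2/3) u\<^sub>1' - (1 / sqrt 3) u\<^sub>3' - \<sigma> u\<^sub>2\<close> and
  \<open>v\<^sub>3 = - (1 / sqrt 3) u\<^sub>2' - \<sigma> u\<^sub>3\<close> as distributions. On this maximal domain only the
  combination of \<open>u\<^sub>1\<close> and \<open>u\<^sub>3\<close> in the second equation needs to be weakly differentiable,
  not \<open>u\<^sub>1\<close> and \<open>u\<^sub>3\<close> separately.\<close>

definition GT_operator ::
    "(real \<Rightarrow> real) \<Rightarrow> ((torus_L2 \<times> torus_L2 \<times> torus_L2) \<times> (torus_L2 \<times> torus_L2 \<times> torus_L2)) set"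
  where "GT_operator \<sigma> = {((u1, u2, u3), (v1, v2, v3)).
    weak_deriv (sqrt (2 / 3) *\<^sub>R u2) (- v1) \<and>
    weak_deriv (sqrt (2 / 3) *\<^sub>R u1 + (1 / sqrt 3) *\<^sub>R u3) (- v2 - mult_L2 \<sigma> u2) \<and>
    weak_deriv ((1 / sqrt 3) *\<^sub>R u2) (- v3 - mult_L2 \<sigma> u3)}"

section \<open>The Lyapunov functional\<close>

definition antideriv :: "(real \<Rightarrow> real) \<Rightarrow> real \<Rightarrow> real"
  where "antideriv f x =
    (LINT y:{0..x}|lebesgue. f y)
      - (1 / (2 * pi)) * (LINT z:{0..2 * pi}|lebesgue. (LINT y:{0..z}|lebesgue. f y))"

definition GT_energy :: "real \<Rightarrow> torus_L2 \<Rightarrow> torus_L2 \<Rightarrow> torus_L2 \<Rightarrow> real"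
  where "GT_energy \<theta> f g h = (norm f)\<^sup>2 + (norm g)\<^sup>2 + (norm h)\<^sup>2
    - \<theta> / (2 * pi) * (LINT x:{0..2 * pi}|lebesgue. antideriv (rep_L2 f) x * rep_L2 g x)"

definition const_L2 :: "real \<Rightarrow> torus_L2"
  where "const_L2 c = to_L2 (\<lambda>x. c)"

section \<open>Essential bounds\<close>

definition ess_sup :: "(real \<Rightarrow> real) \<Rightarrow> ereal"
  where "ess_sup f = esssup torus (\<lambda>x. ereal (f x))"

definition ess_inf :: "(real \<Rightarrow> real) \<Rightarrow> ereal"
  where "ess_inf f = - esssup torus (\<lambda>x. - ereal (f x))"

definition L_infinity :: "(real \<Rightarrow> real) \<Rightarrow> bool"
  where "L_infinity f \<longleftrightarrow> f \<in> borel_measurable torus \<and> ess_sup (\<lambda>x. \<bar>f x\<bar>) < \<infinity>"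

end

theory Submission
  imports Defs
begin

text \<open>Let \<open>P\<close> be the mean-free anti-derivative and \<open>w = u\<^sub>1 - u\<^sub>\<infinity>\<close>. On the domain of the generator the
  transport terms cancel, and \<open>P\<close> inverts the weak derivative on mean-free functions, so that
  \<open>d/dt E + \<alpha> E\<close> equals \<open>- \<theta> a (mean u\<^sub>2)\<^sup>2\<close>, \<open>a = sqrt (2/3)\<close>, plus the integral of
  \<open>- (2\<sigma> - a\<theta> - \<alpha>) u\<^sub>2\<^sup>2 + \<theta> (\<sigma> - \<alpha>) (P w) u\<^sub>2 - (2\<sigma> - \<alpha>) u\<^sub>3\<^sup>2 - (\<theta> / sqrt 3) w u\<^sub>3 - (a\<theta> - \<alpha>) w\<^sup>2\<close>.
  Completing the squares in \<open>u\<^sub>2\<close> and \<open>u\<^sub>3\<close> and using Wirtinger's inequality for \<open>P w\<close> bounds this by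
  \<open>(S\<^sub>1 + S\<^sub>2 - a \<theta> + \<alpha>) \<parallel>w\<parallel>\<^sup>2 \<le> 0\<close>, where \<open>S\<^sub>1\<close> and \<open>S\<^sub>2\<close> are the two suprema. A general mild solution
  is approximated by its averages over \<open>[t, t + h]\<close>, which stay in the domain.\<close>

section \<open>Integration by parts and Wirtinger's inequality\<close>

text \<open>In the plain squared norm only \<open>u2\<close> and \<open>u3\<close> are damped;
  \<open>w\<close> is not. The cross term of the energy repairs this: in the time derivative of
  \<open>inner (P w) u2\<close>, the transport term of the second equation meets \<open>P w\<close>,
  and moving \<open>P\<close> across returns \<open>- \<theta> a |w|^2\<close>. The price is
  \<open>\<theta> a |u2|^2\<close> and mixed terms, which the damping by \<open>\<sigma>\<close>
  must absorb.

  The obstacle is low regularity. \<open>\<sigma>\<close> is merely bounded and the domain is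
  maximal, so \<open>u1\<close> and \<open>u3\<close> need not be weakly differentiable separately,
  and derivatives lie only in \<open>L^2\<close>. Integration by parts is therefore proved for
  functions given as indefinite integrals: \<open>primitive_on\<close> expresses absolute continuity
  on an interval, with the derivative relation kept in integrated form. Weak derivatives are reduced
  to this case by showing that a class with weak derivative \<open>g\<close> is \<open>P g\<close>
  plus a constant. That rests on a fundamental lemma of the calculus of variations with periodic
  test functions, for which trigonometric polynomials are rich enough.\<close>

definition primitive_on :: "real \<Rightarrow> real \<Rightarrow> (real \<Rightarrow> real) \<Rightarrow> (real \<Rightarrow> real) \<Rightarrow> bool"
  where "primitive_on a b F f \<longleftrightarrow>
    f absolutely_integrable_on {a..b} \<and> (\<forall>x\<in>{a..b}. (f has_integral F x - F a) {a..x})"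

lemma primitive_onD:
  assumes "primitive_on a b F f"
  shows "f absolutely_integrable_on {a..b}" "integrable (lebesgue_on {a..b}) f"
    "x \<in> {a..b} \<Longrightarrow> (f has_integral F x - F a) {a..x}"
  using assms unfolding primitive_on_def
  by (auto intro: absolutely_integrable_imp_integrable)

lemma primitive_on_continuous:
  assumes "primitive_on a b F f"
  shows "continuous_on {a..b} F"
proof -
  have "continuous_on {a..b} (\<lambda>x. F a + integral {a..x} f)"
    using primitive_onD(1)[OF assms]
    by (intro continuous_intros indefinite_integral_continuous_1)
      (simp add: set_lebesgue_integral_eq_integral)
  moreover have "F a + integral {a..x} f = F x" if "x \<in> {a..b}" for x
    using integral_unique[OF primitive_onD(3)[OF assms that]] by simp
  ultimately show ?thesis
    by (rule continuous_on_eq)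
qed

lemma primitive_on_has_integral:
  assumes "primitive_on a b F f" "a \<le> x" "x \<le> y" "y \<le> b"
  shows "(f has_integral F y - F x) {x..y}"
proof -
  have "f integrable_on {x..y}"
    using set_lebesgue_integral_eq_integral(1)[OF primitive_onD(1)[OF assms(1)]] assms
    by (rule_tac integrable_subinterval_real) auto
  then have "(f has_integral (F x - F a) + integral {x..y} f) {a..y}"
    using primitive_onD(3)[OF assms(1), of x] assms
    by (intro has_integral_combine[of a x y]) (auto simp: integrable_integral)
  moreover have "(f has_integral F y - F a) {a..y}"
    using primitive_onD(3)[OF assms(1), of y] assms by auto
  ultimately have "F x - F a + integral {x..y} f = F y - F a"
    by (rule has_integral_unique)
  then have "integral {x..y} f = F y - F x"
    by simp
  then show ?thesis
    using integrable_integral[OF \<open>f integrable_on {x..y}\<close>] by simp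
qed

lemma primitive_on_subinterval:
  assumes "primitive_on a b F f" "a \<le> c" "d \<le> b"
  shows "primitive_on c d F f"
  unfolding primitive_on_def
proof safe
  show "f absolutely_integrable_on {c..d}"
    using primitive_onD(1)[OF assms(1)] assms by (auto intro: set_integrable_subset)
qed (use assms primitive_on_has_integral[OF assms(1)] in auto)

lemma primitive_on_diff_const:
  "primitive_on a b F f \<Longrightarrow> primitive_on a b (\<lambda>x. F x - c) f"
  by (simp add: primitive_on_def)

lemma primitive_on_C1:
  assumes "\<And>x. x \<in> {a..b} \<Longrightarrow> (F has_real_derivative f x) (at x)" "continuous_on {a..b} f"
  shows "primitive_on a b F f"
  unfolding primitive_on_def
proof safe
  show "f absolutely_integrable_on {a..b}"
    using assms(2) by (rule absolutely_integrable_continuous_real)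
  fix x assume "x \<in> {a..b}"
  then show "(f has_integral F x - F a) {a..x}"
    using assms(1)
    by (intro fundamental_theorem_of_calculus)
      (auto simp: has_real_derivative_iff_has_vector_derivative[symmetric] intro: has_field_derivative_at_within)
qed

text \<open>Both sides are the integral of \<open>f x * g y\<close> over the triangle
  \<open>y \<le> x\<close>, taken in the two orders. This is the product rule in a form that never
  differentiates \<open>F\<close> or \<open>G\<close> at a point.\<close>

lemma primitive_on_Fubini:
  assumes F: "primitive_on a b F f" and G: "primitive_on a b G g" and "a \<le> b"
  shows "(LINT x|lebesgue_on {a..b}. f x * (G x - G a)) = (LINT x|lebesgue_on {a..b}. (F b - F x) * g x)"
proof -
  define M where "M = lebesgue_on {a..b}"
  interpret finite_measure M
    unfolding M_def by (rule finite_measure_lebesgue_on) simp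
  interpret pair_sigma_finite M M ..
  have space: "space M = {a..b}"
    by (simp add: M_def)
  have int[simp]: "integrable M f" "integrable M g"
    using primitive_onD(2)[OF F] primitive_onD(2)[OF G] by (auto simp: M_def)
  have [measurable]: "(\<lambda>x. x) \<in> borel_measurable M"
    unfolding M_def by (intro continuous_imp_measurable_on_sets_lebesgue continuous_intros) simp
  have [measurable]: "f \<in> borel_measurable M" "g \<in> borel_measurable M"
    using int by (blast intro: borel_measurable_integrable)+
  have prod: "integrable (M \<Otimes>\<^sub>M M) (\<lambda>p. f (fst p) * g (snd p))"
    by (rule Fubini_integrable) (auto simp: abs_mult)
  have "integrable (M \<Otimes>\<^sub>M M) (\<lambda>p. if snd p \<le> fst p then f (fst p) * g (snd p) else 0)"
    by (rule Bochner_Integration.integrable_bound[OF prod]) auto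
  then have "integrable (M \<Otimes>\<^sub>M M) (\<lambda>(x, y). if y \<le> x then f x * g y else 0)"
    by (simp add: case_prod_beta')
  from Fubini_integral[OF this]
  have swap: "(LINT y|M. LINT x|M. (if y \<le> x then f x * g y else 0))
    = (LINT x|M. LINT y|M. (if y \<le> x then f x * g y else 0))" .
  have restr: "(LINT y|M. (if y \<in> S then h y else 0)) = I"
    if "(h has_integral I) S" "S \<subseteq> {a..b}" "integrable M h" "S \<in> sets borel" for h S and I :: real
  proof -
    have [measurable]: "S \<inter> space M \<in> sets M"
      using that(2,4) by (auto simp: M_def sets_restrict_space)
    have [measurable]: "h \<in> borel_measurable M"
      using that(3) by auto
    have eq: "(if y \<in> S then h y else 0) = indicator (S \<inter> space M) y *\<^sub>R h y" if "y \<in> space M" for y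
      using that by auto
    have "integrable M (\<lambda>y. indicator (S \<inter> space M) y *\<^sub>R h y)"
      using that(3) by (intro integrable_mult_indicator) measurable
    then have "integrable M (\<lambda>y. if y \<in> S then h y else 0)"
      by (rule Bochner_Integration.integrable_cong[THEN iffD1, rotated 2]) (simp_all only: eq)
    then have "((\<lambda>y. if y \<in> S then h y else 0) has_integral (LINT y|M. (if y \<in> S then h y else 0))) {a..b}"
      unfolding M_def by (rule has_integral_integral_lebesgue_on) simp
    moreover have "((\<lambda>y. if y \<in> S then h y else 0) has_integral I) {a..b}"
      using that by (simp add: has_integral_restrict)
    ultimately show ?thesis
      by (rule has_integral_unique)
  qed
  have "(LINT y|M. (if y \<le> x then f x * g y else 0)) = f x * (G x - G a)" if "x \<in> space M" for x
  proof -
    have "(LINT y|M. (if y \<le> x then f x * g y else 0)) = (LINT y|M. f x * (if y \<in> {a..x} then g y else 0))"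
      by (intro Bochner_Integration.integral_cong) (auto simp: space)
    also have "\<dots> = f x * (G x - G a)"
      using that primitive_onD(3)[OF G, of x] by (subst integral_mult_right_zero, subst restr) (auto simp: space)
    finally show ?thesis .
  qed
  moreover have "(LINT x|M. (if y \<le> x then f x * g y else 0)) = (F b - F y) * g y" if "y \<in> space M" for y
  proof -
    have "(LINT x|M. (if y \<le> x then f x * g y else 0)) = (LINT x|M. (if x \<in> {y..b} then f x else 0) * g y)"
      by (intro Bochner_Integration.integral_cong) (auto simp: space)
    also have "\<dots> = (F b - F y) * g y"
      using that primitive_on_has_integral[OF F, of y b]
      by (subst integral_mult_left_zero, subst restr) (auto simp: space)
    finally show ?thesis .
  qed
  ultimately show ?thesis
    using swap unfolding M_def[symmetric] by (simp cong: Bochner_Integration.integral_cong)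
qed

lemma primitive_on_integrable_mult:
  assumes "primitive_on a b F f" "g absolutely_integrable_on {a..b}"
  shows "(\<lambda>x. F x * g x) absolutely_integrable_on {a..b}"
  using assms primitive_on_continuous[OF assms(1)]
  by (intro absolutely_integrable_bounded_measurable_product_real
      continuous_imp_measurable_on_sets_lebesgue compact_imp_bounded compact_continuous_image) auto

text \<open>Multiplying out \<open>primitive_on_Fubini\<close> on \<open>{a..c}\<close> leaves the
  boundary values \<open>F c * G c - F a * G a\<close>. Since products are again primitives, the
  rule can be iterated to three factors.\<close>

lemma primitive_on_mult:
  assumes F: "primitive_on a b F f" and G: "primitive_on a b G g"
  shows "primitive_on a b (\<lambda>x. F x * G x) (\<lambda>x. f x * G x + F x * g x)"
  unfolding primitive_on_def
proof safe
  have fG: "(\<lambda>x. f x * G x) absolutely_integrable_on {a..b}"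
    using primitive_on_integrable_mult[OF G primitive_onD(1)[OF F]] by (simp add: mult.commute)
  have Fg: "(\<lambda>x. F x * g x) absolutely_integrable_on {a..b}"
    using primitive_on_integrable_mult[OF F primitive_onD(1)[OF G]] .
  show "(\<lambda>x. f x * G x + F x * g x) absolutely_integrable_on {a..b}"
    using fG Fg by (rule set_integral_add)
  fix c assume c: "c \<in> {a..b}"
  have F': "primitive_on a c F f" and G': "primitive_on a c G g"
    using c by (auto intro: primitive_on_subinterval[OF F] primitive_on_subinterval[OF G])
  have int: "integrable (lebesgue_on {a..c}) (\<lambda>x. f x * G x)" "integrable (lebesgue_on {a..c}) (\<lambda>x. F x * g x)"
    using fG Fg c by (auto intro!: absolutely_integrable_imp_integrable intro: set_integrable_subset)
  note intf = primitive_onD(2)[OF F'] primitive_onD(2)[OF G']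
  have val: "(LINT x|lebesgue_on {a..c}. f x) = F c - F a" "(LINT x|lebesgue_on {a..c}. g x) = G c - G a"
    using has_integral_integral_lebesgue_on[OF intf(1)] has_integral_integral_lebesgue_on[OF intf(2)]
      primitive_onD(3)[OF F', of c] primitive_onD(3)[OF G', of c] c
    by (auto intro: has_integral_unique)
  have "(LINT x|lebesgue_on {a..c}. f x * G x + F x * g x) = F c * G c - F a * G a"
    using primitive_on_Fubini[OF F' G'] c int intf
    by (simp add: right_diff_distrib left_diff_distrib val)
  then show "((\<lambda>x. f x * G x + F x * g x) has_integral F c * G c - F a * G a) {a..c}"
    using has_integral_integral_lebesgue_on[OF Bochner_Integration.integrable_add[OF int]] by simp
qed

text \<open>Expand the integral of \<open>(g + w G)\<^sup>2 \<ge> 0\<close> with \<open>w x = k tan (k (x - m))\<close>, which solves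
  \<open>w' = k\<^sup>2 + w\<^sup>2\<close>; for \<open>k < 1\<close> it is smooth on the closed interval of length \<open>\<pi>\<close> around \<open>m\<close>.\<close>

lemma Wirtinger_weighted:
  assumes G: "primitive_on a b G g" and g2: "(\<lambda>x. (g x)\<^sup>2) integrable_on {a..b}"
    and k: "0 < k" "k < 1" and m: "m - pi / 2 \<le> a" "a \<le> b" "b \<le> m + pi / 2"
  shows "k\<^sup>2 * integral {a..b} (\<lambda>x. (G x)\<^sup>2) \<le> integral {a..b} (\<lambda>x. (g x)\<^sup>2)
    + (G b)\<^sup>2 * (k * tan (k * (b - m))) - (G a)\<^sup>2 * (k * tan (k * (a - m)))"
proof -
  define w where "w x = k * tan (k * (x - m))" for x
  have cos: "cos (k * (x - m)) \<noteq> 0" if "x \<in> {a..b}" for x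
  proof -
    have "\<bar>x - m\<bar> \<le> pi / 2"
      unfolding abs_le_iff using that m by simp
    then have "k * \<bar>x - m\<bar> \<le> k * (pi / 2)"
      using k by (intro mult_left_mono) auto
    also have "\<dots> < pi / 2"
      using k by simp
    finally have "\<bar>k * (x - m)\<bar> < pi / 2"
      using k by (simp add: abs_mult)
    then show ?thesis
      by (intro less_imp_neq[THEN not_sym] cos_gt_zero_pi) auto
  qed
  have w: "primitive_on a b w (\<lambda>x. k\<^sup>2 + (w x)\<^sup>2)"
  proof (rule primitive_on_C1)
    fix x assume "x \<in> {a..b}"
    note nz = cos[OF this]
    have "(w has_real_derivative k * (inverse ((cos (k * (x - m)))\<^sup>2) * k)) (at x)"
      unfolding w_def using nz by (auto intro!: derivative_eq_intros)
    also have "k * (inverse ((cos (k * (x - m)))\<^sup>2) * k) = k\<^sup>2 + (w x)\<^sup>2"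
    proof -
      have "inverse ((cos (k * (x - m)))\<^sup>2) = 1 + (tan (k * (x - m)))\<^sup>2"
        using tan_sec[OF nz] by (simp add: power_inverse)
      then show ?thesis
        by (simp only:) (simp add: w_def power2_eq_square algebra_simps)
    qed
    finally show "(w has_real_derivative k\<^sup>2 + (w x)\<^sup>2) (at x)" .
  next
    show "continuous_on {a..b} (\<lambda>x. k\<^sup>2 + (w x)\<^sup>2)"
      unfolding w_def using cos by (intro continuous_intros) auto
  qed
  \<comment> \<open>\<open>h\<close> is the product-rule derivative of \<open>G^2 w\<close>, so it
    integrates to boundary values; \<open>g^2 + h - k^2 G^2\<close> is exactly the square of
    \<open>g + G w\<close>.\<close>
  define h where "h x = (g x * G x + G x * g x) * w x + (G x * G x) * (k\<^sup>2 + (w x)\<^sup>2)" for x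
  have h: "(h has_integral G b * G b * w b - G a * G a * w a) {a..b}"
    using primitive_onD(3)[OF primitive_on_mult[OF primitive_on_mult[OF G G] w], of b] m by (simp add: h_def[abs_def])
  have G2: "(\<lambda>x. (G x)\<^sup>2) integrable_on {a..b}"
    using primitive_on_continuous[OF G] by (intro integrable_continuous_real continuous_intros)
  have "((\<lambda>x. (g x)\<^sup>2 + h x - k\<^sup>2 * (G x)\<^sup>2) has_integral
    integral {a..b} (\<lambda>x. (g x)\<^sup>2) + (G b * G b * w b - G a * G a * w a)
      - k\<^sup>2 * integral {a..b} (\<lambda>x. (G x)\<^sup>2)) {a..b}"
    using g2 G2 h by (intro has_integral_diff has_integral_add has_integral_mult_right integrable_integral)
  then have "0 \<le> integral {a..b} (\<lambda>x. (g x)\<^sup>2) + (G b * G b * w b - G a * G a * w a)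
      - k\<^sup>2 * integral {a..b} (\<lambda>x. (G x)\<^sup>2)"
  proof (rule has_integral_nonneg)
    fix x
    have "(g x)\<^sup>2 + h x - k\<^sup>2 * (G x)\<^sup>2 = (g x + G x * w x)\<^sup>2"
      by (simp add: h_def power2_eq_square algebra_simps)
    then show "0 \<le> (g x)\<^sup>2 + h x - k\<^sup>2 * (G x)\<^sup>2"
      by simp
  qed
  then show ?thesis
    by (simp add: w_def power2_eq_square)
qed

text \<open>There is \<open>x0\<close> with \<open>F (x0 + \<pi>) = F x0\<close>. Subtracting this value makes the boundary terms of the
  weighted inequality vanish at \<open>x0\<close> and \<open>x0 + \<pi>\<close>, and those at \<open>0\<close> and \<open>2\<pi>\<close> cancel.\<close>

lemma Wirtinger:
  assumes F: "primitive_on 0 (2 * pi) F f" and f2: "(\<lambda>x. (f x)\<^sup>2) integrable_on {0..2 * pi}"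
    and per: "F (2 * pi) = F 0" and mean: "integral {0..2 * pi} F = 0"
  shows "integral {0..2 * pi} (\<lambda>x. (F x)\<^sup>2) \<le> integral {0..2 * pi} (\<lambda>x. (f x)\<^sup>2)"
proof -
  note cont = primitive_on_continuous[OF F]
  define d where "d x = F (x + pi) - F x" for x
  have d_cont: "continuous_on {0..pi} d"
    unfolding d_def using cont
    by (intro continuous_intros continuous_on_compose2[OF cont]) auto
  \<comment> \<open>Periodicity gives \<open>d pi = - d 0\<close>, so \<open>d\<close> changes sign
    on \<open>{0..pi}\<close>.\<close>
  have "\<exists>x0. 0 \<le> x0 \<and> x0 \<le> pi \<and> d x0 = 0"
  proof (cases "d 0 \<le> 0")
    case True
    then show ?thesis
      using per by (intro IVT'[OF _ _ _ d_cont]) (auto simp: d_def)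
  next
    case False
    then show ?thesis
      using per by (intro IVT2'[OF _ _ _ d_cont]) (auto simp: d_def)
  qed
  then obtain x0 where x0: "0 \<le> x0" "x0 \<le> pi" "F (x0 + pi) = F x0"
    by (auto simp: d_def)
  define G where "G x = F x - F x0" for x
  have G: "primitive_on 0 (2 * pi) G f"
    unfolding G_def by (rule primitive_on_diff_const[OF F])
  have G2: "(\<lambda>x. (G x)\<^sup>2) integrable_on {0..2 * pi}"
    using primitive_on_continuous[OF G] by (intro integrable_continuous_real continuous_intros)
  have G0: "G x0 = 0" "G (x0 + pi) = 0" "G (2 * pi) = G 0"
    using x0 per by (auto simp: G_def)
  have split: "integral {0..2 * pi} h = integral {0..x0} h + integral {x0..x0 + pi} h + integral {x0 + pi..2 * pi} h"
    if "h integrable_on {0..2 * pi}" for h :: "real \<Rightarrow> real"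
  proof -
    have "h integrable_on {x0..2 * pi}"
      using that x0 by (auto intro: integrable_subinterval_real)
    then show ?thesis
      using that x0 Henstock_Kurzweil_Integration.integral_combine[of 0 x0 "2 * pi" h]
        Henstock_Kurzweil_Integration.integral_combine[of x0 "x0 + pi" "2 * pi" h]
      by simp
  qed
  have k: "k\<^sup>2 * integral {0..2 * pi} (\<lambda>x. (G x)\<^sup>2) \<le> integral {0..2 * pi} (\<lambda>x. (f x)\<^sup>2)"
    if "0 < k" "k < 1" for k
  proof -
    have *: "k\<^sup>2 * integral {a..b} (\<lambda>x. (G x)\<^sup>2) \<le> integral {a..b} (\<lambda>x. (f x)\<^sup>2)
      + (G b)\<^sup>2 * (k * tan (k * (b - m))) - (G a)\<^sup>2 * (k * tan (k * (a - m)))"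
      if "0 \<le> a" "a \<le> b" "b \<le> 2 * pi" "m - pi / 2 \<le> a" "b \<le> m + pi / 2" for a b m
      using that \<open>0 < k\<close> \<open>k < 1\<close>
      by (intro Wirtinger_weighted primitive_on_subinterval[OF G] integrable_subinterval_real[OF f2]) auto
    \<comment> \<open>The weights are centred at \<open>x0 - pi / 2\<close>,
      \<open>x0 + pi / 2\<close> and \<open>x0 + 3 * pi / 2\<close>. The outer two centres differ by
      a full period, so the weight at \<open>2 * pi\<close> equals the one at \<open>0\<close>, and
      \<open>G (2 * pi) = G 0\<close> cancels the terms.\<close>
    have eq: "2 * pi - (x0 + 3 * pi / 2) = 0 - (x0 - pi / 2)"
      by simp
    show ?thesis
      using *[of 0 x0 "x0 - pi / 2"] *[of x0 "x0 + pi" "x0 + pi / 2"] *[of "x0 + pi" "2 * pi" "x0 + 3 * pi / 2"] x0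
      unfolding split[OF G2] split[OF f2] eq by (simp add: G0 distrib_left)
  qed
  \<comment> \<open>For \<open>k = 1\<close> the weight blows up at distance \<open>pi / 2\<close>
    from its centre, so the sharp constant is only reached as a limit.\<close>
  have "((\<lambda>k. k\<^sup>2 * integral {0..2 * pi} (\<lambda>x. (G x)\<^sup>2)) \<longlongrightarrow> 1\<^sup>2 * integral {0..2 * pi} (\<lambda>x. (G x)\<^sup>2)) (at_left 1)"
    by (intro tendsto_intros)
  moreover have "eventually (\<lambda>k. k\<^sup>2 * integral {0..2 * pi} (\<lambda>x. (G x)\<^sup>2) \<le> integral {0..2 * pi} (\<lambda>x. (f x)\<^sup>2))
    (at_left (1 :: real))"
    using eventually_at_left_real[OF zero_less_one] by eventually_elim (use k in auto)
  ultimately have "integral {0..2 * pi} (\<lambda>x. (G x)\<^sup>2) \<le> integral {0..2 * pi} (\<lambda>x. (f x)\<^sup>2)"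
    using tendsto_upperbound[of "\<lambda>k. k\<^sup>2 * integral {0..2 * pi} (\<lambda>x. (G x)\<^sup>2)" _ "at_left 1"] by simp
  \<comment> \<open>Zero mean removes the cross term, so the shift by \<open>F x0\<close> can only
    enlarge the square integral, which is the harmless direction.\<close>
  moreover have "integral {0..2 * pi} (\<lambda>x. (G x)\<^sup>2)
    = integral {0..2 * pi} (\<lambda>x. (F x)\<^sup>2) - 2 * F x0 * integral {0..2 * pi} F + 2 * pi * (F x0)\<^sup>2"
  proof -
    have "((\<lambda>x. (F x)\<^sup>2 - 2 * F x0 * F x + (F x0)\<^sup>2) has_integral
      integral {0..2 * pi} (\<lambda>x. (F x)\<^sup>2) - 2 * F x0 * integral {0..2 * pi} F + 2 * pi * (F x0)\<^sup>2) {0..2 * pi}"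
      using cont has_integral_const_real[of "(F x0)\<^sup>2" 0 "2 * pi"]
      by (intro has_integral_add has_integral_diff has_integral_mult_right integrable_integral
          integrable_continuous_real continuous_intros) simp_all
    from integral_unique[OF this] show ?thesis
      by (simp add: G_def power2_diff algebra_simps)
  qed
  moreover have "0 \<le> 2 * pi * (F x0)\<^sup>2"
    by simp
  ultimately show ?thesis
    unfolding mean by linarith
qed

section \<open>Trigonometric polynomials\<close>

text \<open>The free phase \<open>d\<close> covers sines as well. One kind of generator is then
  closed under products (sum and difference of frequencies, hence integer \<open>n\<close>) and
  under differentiation (phase shift by \<open>pi / 2\<close>).\<close>

inductive_set trigpoly :: "(real \<Rightarrow> real) set"
  where cos: "(\<lambda>x. c * cos (of_int n * x + d)) \<in> trigpoly"
  | add: "f \<in> trigpoly \<Longrightarrow> g \<in> trigpoly \<Longrightarrow> (\<lambda>x. f x + g x) \<in> trigpoly"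

lemma trigpoly_const: "(\<lambda>x. c) \<in> trigpoly"
  using trigpoly.cos[of c 0 0] by simp

lemma trigpoly_mult:
  assumes "f \<in> trigpoly" "g \<in> trigpoly"
  shows "(\<lambda>x. f x * g x) \<in> trigpoly"
  using assms
proof induction
  case (cos a n d)
  from cos.prems show ?case
  proof induction
    case (cos b m e)
    have *: "(\<lambda>x. a * cos (of_int n * x + d) * (b * cos (of_int m * x + e))) =
      (\<lambda>x. (a * b / 2) * cos (of_int (n - m) * x + (d - e)) + (a * b / 2) * cos (of_int (n + m) * x + (d + e)))"
    proof
      fix x
      have product: "cos (of_int n * x + d) * cos (of_int m * x + e)
        = (cos (of_int (n - m) * x + (d - e)) + cos (of_int (n + m) * x + (d + e))) / 2"
        unfolding cos_times_cos by (simp add: algebra_simps)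
      have "a * cos (of_int n * x + d) * (b * cos (of_int m * x + e))
          = a * b * (cos (of_int n * x + d) * cos (of_int m * x + e))"
        by simp
      also have "\<dots> = (a * b / 2) * cos (of_int (n - m) * x + (d - e)) + (a * b / 2) * cos (of_int (n + m) * x + (d + e))"
        unfolding product by (simp add: field_simps)
      finally show "a * cos (of_int n * x + d) * (b * cos (of_int m * x + e)) =
         (a * b / 2) * cos (of_int (n - m) * x + (d - e)) + (a * b / 2) * cos (of_int (n + m) * x + (d + e))" .
    qed
    show ?case
      unfolding * by (intro trigpoly.intros)
  next
    case (add f g)
    then show ?case
      using trigpoly.add[OF add.IH] by (simp add: distrib_left)
  qed
next
  case (add f h)
  then show ?case
    using trigpoly.add[OF add.IH(1) add.IH(2)] by (simp add: distrib_right)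
qed

lemma trigpoly_deriv:
  assumes "f \<in> trigpoly"
  shows "deriv f \<in> trigpoly \<and> (\<forall>x. (f has_real_derivative deriv f x) (at x))"
proof -
  have "\<exists>g\<in>trigpoly. \<forall>x. (f has_real_derivative g x) (at x)"
    using assms
  proof induction
    case (cos c n d)
    have "((\<lambda>x. c * cos (of_int n * x + d)) has_real_derivative c * of_int n * cos (of_int n * x + (d + pi / 2))) (at x)" for x
      by (auto intro!: derivative_eq_intros simp: minus_sin_cos_eq add.assoc)
    then show ?case
      by (intro bexI[OF _ trigpoly.cos]) blast
  next
    case (add f g)
    then obtain f' g' where "f' \<in> trigpoly" "\<And>x. (f has_real_derivative f' x) (at x)"
      "g' \<in> trigpoly" "\<And>x. (g has_real_derivative g' x) (at x)"
      by blast
    then show ?case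
      by (intro bexI[of _ "\<lambda>x. f' x + g' x"]) (auto intro: trigpoly.add DERIV_add)
  qed
  then obtain g where g: "g \<in> trigpoly" "\<And>x. (f has_real_derivative g x) (at x)"
    by blast
  then have "deriv f = g"
    by (intro ext DERIV_imp_deriv)
  with g show ?thesis
    by simp
qed

lemma trigpoly_periodic:
  assumes "f \<in> trigpoly"
  shows "f (x + 2 * pi) = f x"
  using assms
proof induction
  case (cos c n d)
  have "cos (of_int n * (x + 2 * pi) + d) = cos ((of_int n * x + d) + 2 * pi * of_int n)"
    by (simp add: algebra_simps)
  also have "\<dots> = cos (of_int n * x + d)"
    by (simp only: cos_add cos_int_2pin sin_int_2pin) simp
  finally show ?case
    by simp
qed auto

lemma trigpoly_test_function:
  assumes "f \<in> trigpoly"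
  shows "test_function f"
proof -
  have "(deriv ^^ n) f \<in> trigpoly" for n
    by (induction n) (use assms trigpoly_deriv in auto)
  then show ?thesis
    using trigpoly_periodic[OF assms] trigpoly_deriv
    unfolding test_function_def by (metis field_differentiable_def)
qed

text \<open>Only terms of frequency 0 lack a periodic primitive; the others are divided by
  \<open>n\<close>. Testing against all trigonometric polynomials thus reduces to testing against
  constants and derivatives.\<close>

lemma trigpoly_primitive:
  assumes "f \<in> trigpoly"
  shows "\<exists>c. \<exists>g\<in>trigpoly. \<forall>x. f x = c + deriv g x"
  using assms
proof induction
  case (cos a n d)
  show ?case
  proof (cases "n = 0")
    case True
    then show ?thesis
      by (intro exI[of _ "a * cos d"] bexI[OF _ trigpoly_const]) auto
  next
    case False
    have "deriv (\<lambda>x. a / of_int n * cos (of_int n * x + (d - pi / 2))) x = a * cos (of_int n * x + d)" for x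
      using False by (intro DERIV_imp_deriv) (auto intro!: derivative_eq_intros simp: minus_sin_cos_eq)
    then show ?thesis
      by (intro exI[of _ 0] bexI[OF _ trigpoly.cos[of "a / of_int n" n "d - pi / 2"]]) simp
  qed
next
  case (add f g)
  then obtain c d f' g' where *: "f' \<in> trigpoly" "g' \<in> trigpoly" "\<And>x. f x = c + deriv f' x" "\<And>x. g x = d + deriv g' x"
    by blast
  have "deriv (\<lambda>x. f' x + g' x) x = deriv f' x + deriv g' x" for x
    using trigpoly_deriv[OF *(1)] trigpoly_deriv[OF *(2)] by (intro DERIV_imp_deriv DERIV_add) auto
  with * show ?case
    by (intro exI[of _ "c + d"] bexI[OF _ trigpoly.add[OF *(1,2)]]) auto
qed

text \<open>A real linear functional of \<open>cis x\<close> is a combination of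
  \<open>cos x\<close> and \<open>sin x\<close>, and the class is closed under sums and
  products.\<close>

lemma trigpoly_polynomial_circle:
  assumes "real_polynomial_function p"
  shows "(\<lambda>x. p (cis x)) \<in> trigpoly"
  using assms
proof induction
  case (linear f)
  interpret f: bounded_linear f by fact
  have eq: "f (cis x) = f 1 * cos (of_int 1 * x + 0) + f \<i> * cos (of_int 1 * x + - pi / 2)" for x
  proof -
    have "cis x = cos x *\<^sub>R 1 + sin x *\<^sub>R \<i>"
      by (simp add: complex_eq_iff)
    then have "f (cis x) = cos x * f 1 + sin x * f \<i>"
      by (simp add: f.add f.scaleR)
    moreover have "sin x = cos (x - pi / 2)"
      by (simp add: cos_diff)
    ultimately show ?thesis by simp
  qed
  show ?case
    unfolding eq by (intro trigpoly.intros)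
qed (auto intro: trigpoly_const trigpoly.add trigpoly_mult)

text \<open>Stone-Weierstrass on the unit circle. Writing periodic functions as functions of
  \<open>cis x\<close> builds the matching of the endpoints into the approximation.\<close>

lemma trigpoly_dense:
  fixes G :: "complex \<Rightarrow> real"
  assumes "continuous_on UNIV G" "0 < e"
  shows "\<exists>p\<in>trigpoly. \<forall>x. \<bar>G (cis x) - p x\<bar> < e"
proof -
  have "compact (sphere 0 1 :: complex set)" "continuous_on (sphere 0 1) G"
    using assms continuous_on_subset by auto
  from Stone_Weierstrass_polynomial_function[OF this assms(2)]
  obtain g where g: "polynomial_function g" "\<And>z. z \<in> sphere 0 1 \<Longrightarrow> norm (G z - g z) < e"
    by blast
  then have "\<bar>G (cis x) - g (cis x)\<bar> < e" for x
    by (auto simp: real_norm_def[symmetric] simp del: real_norm_def)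
  moreover have "(\<lambda>x. g (cis x)) \<in> trigpoly"
    using g(1) by (intro trigpoly_polynomial_circle) (simp add: real_polynomial_function_eq)
  ultimately show ?thesis
    by (intro bexI[of _ "\<lambda>x. g (cis x)"] allI)
qed

text \<open>Replacing \<open>G (cis x)\<close> by a uniformly close trigonometric polynomial costs
  at most \<open>e\<close> times the \<open>L^1\<close> norm of \<open>h\<close>.\<close>

lemma integral_continuous_circle_eq_0:
  fixes h :: "real \<Rightarrow> real" and G :: "complex \<Rightarrow> real"
  assumes h: "integrable torus h" and ortho: "\<And>p. p \<in> trigpoly \<Longrightarrow> (LINT x|torus. h x * p x) = 0"
    and G: "continuous_on UNIV G"
  shows "(LINT x|torus. h x * G (cis x)) = 0"
proof -
  have meas: "f \<in> borel_measurable torus" if "continuous_on UNIV f" for f :: "real \<Rightarrow> real"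
    using that by (intro continuous_imp_measurable_on_sets_lebesgue) (auto intro: continuous_on_subset)
  have "continuous_on UNIV (\<lambda>x. G (cis x))"
    by (intro continuous_on_compose2[OF G] continuous_intros) auto
  note [measurable] = meas[OF this] borel_measurable_integrable[OF h]
  have bound: "\<bar>LINT x|torus. h x * G (cis x)\<bar> \<le> e * (LINT x|torus. \<bar>h x\<bar>)" if e: "0 < e" for e
  proof -
    obtain p where p: "p \<in> trigpoly" "\<And>x. \<bar>G (cis x) - p x\<bar> < e"
      using trigpoly_dense[OF G e] by blast
    have "continuous_on UNIV p"
      using trigpoly_deriv[OF p(1)] DERIV_isCont by (auto intro!: continuous_at_imp_continuous_on)
    note [measurable] = meas[OF this]
    have le: "\<bar>h x * (G (cis x) - p x)\<bar> \<le> e * \<bar>h x\<bar>" for x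
      using mult_right_mono[OF less_imp_le[OF p(2)[of x]] abs_ge_zero[of "h x"]] by (simp add: abs_mult mult.commute)
    have d: "integrable torus (\<lambda>x. h x * (G (cis x) - p x))"
      by (rule Bochner_Integration.integrable_bound[OF integrable_mult_right[OF h, of e]])
        (use le e in \<open>auto simp: abs_mult[of e]\<close>)
    have p_int: "integrable torus (\<lambda>x. h x * p x)"
    proof -
      have "compact (p ` {0..2 * pi})"
        using \<open>continuous_on UNIV p\<close> by (intro compact_continuous_image) (auto intro: continuous_on_subset)
      then have "bounded (p ` {0..2 * pi})"
        by (rule compact_imp_bounded)
      then obtain B where B: "\<And>x. x \<in> {0..2 * pi} \<Longrightarrow> \<bar>p x\<bar> \<le> B"
        by (metis bounded_iff image_eqI real_norm_def)
      have "\<bar>h x * p x\<bar> \<le> \<bar>B * h x\<bar>" if "x \<in> {0..2 * pi}" for x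
        using mult_right_mono[OF order_trans[OF B[OF that] abs_ge_self] abs_ge_zero[of "h x"]]
        by (simp add: abs_mult mult.commute)
      then show ?thesis
        by (intro Bochner_Integration.integrable_bound[OF integrable_mult_right[OF h, of B]]) auto
    qed
    have "(LINT x|torus. h x * G (cis x)) = (LINT x|torus. h x * (G (cis x) - p x) + h x * p x)"
      by (simp add: algebra_simps)
    also have "\<dots> = (LINT x|torus. h x * (G (cis x) - p x))"
      using d p_int ortho[OF p(1)] by simp
    finally have "\<bar>LINT x|torus. h x * G (cis x)\<bar> \<le> (LINT x|torus. \<bar>h x * (G (cis x) - p x)\<bar>)"
      by simp
    also have "\<dots> \<le> (LINT x|torus. e * \<bar>h x\<bar>)"
      using le d h by (intro integral_mono) auto
    finally show ?thesis
      by simp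
  qed
  show ?thesis
  proof (rule ccontr)
    assume nz: "(LINT x|torus. h x * G (cis x)) \<noteq> 0"
    define I where "I = (LINT x|torus. \<bar>h x\<bar>)"
    define J where "J = \<bar>LINT x|torus. h x * G (cis x)\<bar>"
    have "I \<ge> 0"
      unfolding I_def by simp
    have "J > 0"
      using nz by (simp add: J_def)
    \<comment> \<open>The tolerance is \<open>J / (I + 1)\<close>: the added 1 avoids division by
      zero and makes the resulting bound strictly smaller than \<open>J\<close>.\<close>
    then have "J \<le> J / (I + 1) * I"
      using bound[of "J / (I + 1)"] \<open>I \<ge> 0\<close> by (simp add: I_def[symmetric] J_def[symmetric])
    also have "\<dots> < J"
      using \<open>J > 0\<close> \<open>I \<ge> 0\<close> by (simp add: field_simps)
    finally show False
      by simp
  qed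
qed

text \<open>The indicator of \<open>K\<close> is a limit of continuous functions on the circle,
  under the fixed bound \<open>\<bar>h x\<bar>\<close>. Leaving \<open>2 * pi\<close> out of
  \<open>K\<close> keeps \<open>cis\<close> injective; nonemptiness matters because
  \<open>infdist\<close> to the empty set is 0, which would make the limit 1.\<close>

lemma integral_compact_eq_0:
  fixes h :: "real \<Rightarrow> real"
  assumes h: "integrable torus h" and ortho: "\<And>p. p \<in> trigpoly \<Longrightarrow> (LINT x|torus. h x * p x) = 0"
    and K: "compact K" "K \<subseteq> {0..<2 * pi}" "K \<noteq> {}"
  shows "(LINT x|torus. h x * indicator K x) = 0"
proof -
  have cis_inj: "x = y" if "x \<in> {0..<2 * pi}" "y \<in> {0..<2 * pi}" "cis x = cis y" for x y
  proof -
    from that(3) obtain n :: int where n: "x = y + 2 * pi * of_int n"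
      using sin_cos_eq_iff[of x y] by (auto simp: complex_eq_iff)
    then have "\<bar>2 * pi * of_int n\<bar> < 2 * pi * 1"
      using that(1,2) by auto
    then have "n = 0"
      by (simp add: abs_mult)
    with n show ?thesis by simp
  qed
  note [measurable] = borel_measurable_integrable[OF h]
  \<comment> \<open>continuous functions on the circle decreasing to the indicator of \<open>K\<close>\<close>
  define G where "G n z = max 0 (1 - real n * infdist z (cis ` K))" for n z
  have G_cont: "continuous_on UNIV (G n)" for n
    unfolding G_def by (intro continuous_intros)
  have G_bound: "0 \<le> G n z" "G n z \<le> 1" for n z
    by (auto simp: G_def infdist_nonneg)
  have lim: "(\<lambda>n. G n (cis x)) \<longlonglongrightarrow> indicator K x" if x: "x \<in> {0..<2 * pi}" for x
  proof -
    have "cis x \<in> cis ` K \<longleftrightarrow> x \<in> K"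
    proof
      assume "cis x \<in> cis ` K"
      then obtain y where "y \<in> K" "cis x = cis y"
        by auto
      then have "y = x"
        using x K(2) by (intro cis_inj) (use x K(2) in auto)
      with \<open>y \<in> K\<close> show "x \<in> K" by simp
    qed auto
    moreover have "closed (cis ` K)"
      using K(1) by (intro compact_imp_closed compact_continuous_image continuous_intros)
    ultimately have iff: "infdist (cis x) (cis ` K) = 0 \<longleftrightarrow> x \<in> K"
      using K(3) in_closed_iff_infdist_zero[of "cis ` K"] by auto
    show ?thesis
    proof (cases "x \<in> K")
      case True
      then show ?thesis using iff by (simp add: G_def)
    next
      case False
      define r where "r = infdist (cis x) (cis ` K)"
      have "r > 0"
        using False iff infdist_nonneg[of "cis x" "cis ` K"] unfolding r_def by linarith
      then obtain N where N: "real N * r > 1"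
        using reals_Archimedean3 by blast
      have "eventually (\<lambda>n. G n (cis x) = 0) sequentially"
        using eventually_ge_at_top[of N]
      proof eventually_elim
        case (elim n)
        then have "real N * r \<le> real n * r"
          using \<open>r > 0\<close> by simp
        with N show ?case
          by (simp add: G_def r_def[symmetric])
      qed
      with False show ?thesis
        by (simp add: tendsto_eventually)
    qed
  qed
  have [measurable]: "K \<in> sets borel"
    using K(1) by (simp add: compact_imp_closed)
  have [measurable]: "(\<lambda>x. x) \<in> torus \<rightarrow>\<^sub>M borel"
    by (intro continuous_imp_measurable_on_sets_lebesgue continuous_intros) simp
  have "(\<lambda>n. LINT x|torus. h x * G n (cis x)) \<longlonglongrightarrow> (LINT x|torus. h x * indicator K x)"
  proof (rule integral_dominated_convergence)
    show "integrable torus (\<lambda>x. \<bar>h x\<bar>)"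
      using h by simp
    show "(\<lambda>x. h x * indicator K x) \<in> borel_measurable torus"
      by measurable
    fix n
    have "continuous_on UNIV (\<lambda>x. G n (cis x))"
      by (intro continuous_on_compose2[OF G_cont] continuous_intros) auto
    then have [measurable]: "(\<lambda>x. G n (cis x)) \<in> borel_measurable torus"
      by (intro continuous_imp_measurable_on_sets_lebesgue) (auto intro: continuous_on_subset)
    show "(\<lambda>x. h x * G n (cis x)) \<in> borel_measurable torus"
      by measurable
    show "AE x in torus. norm (h x * G n (cis x)) \<le> \<bar>h x\<bar>"
      using G_bound[of n] by (auto simp: abs_mult intro!: mult_left_le)
  next
    \<comment> \<open>At \<open>2 * pi\<close> the functions converge to the indicator at
      \<open>0\<close>, since \<open>cis\<close> agrees there; this one point is discarded as a null
      set.\<close>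
    have "AE x in torus. x \<noteq> 2 * pi"
      by (subst AE_restrict_space_iff) (auto intro!: AE_I[of _ _ "{2 * pi}"])
    then show "AE x in torus. (\<lambda>n. h x * G n (cis x)) \<longlonglongrightarrow> h x * indicator K x"
    proof (rule AE_mp, intro AE_I2 impI)
      fix x assume "x \<in> space torus" "x \<noteq> 2 * pi"
      then show "(\<lambda>n. h x * G n (cis x)) \<longlonglongrightarrow> h x * indicator K x"
        by (intro tendsto_mult tendsto_const lim) auto
    qed
  qed
  moreover have "(LINT x|torus. h x * G n (cis x)) = 0" for n
    by (rule integral_continuous_circle_eq_0[OF h ortho G_cont])
  ultimately show ?thesis
    by (simp add: LIMSEQ_const_iff)
qed

text \<open>If \<open>h > e > 0\<close> held on a set of positive measure, inner regularity would
  give a compact subset of positive measure, over which the integral of \<open>h\<close> would be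
  positive as well as zero.\<close>

lemma AE_nonpos_if_orthogonal_trigpoly:
  fixes h :: "real \<Rightarrow> real"
  assumes h: "integrable torus h" and ortho: "\<And>p. p \<in> trigpoly \<Longrightarrow> (LINT x|torus. h x * p x) = 0"
  shows "AE x in torus. h x \<le> 0"
proof -
  note [measurable] = borel_measurable_integrable[OF h]
  have *: "AE x in torus. h x \<le> e" if e: "0 < e" for e
  proof -
    define A where "A = {x \<in> {0..<2 * pi}. h x > e}"
    have "{x \<in> space torus. h x > e} \<inter> {0..<2 * pi} \<in> sets lebesgue"
    proof -
      have "{x \<in> space torus. h x > e} \<in> sets torus"
        by measurable
      then have "{x \<in> space torus. h x > e} \<in> sets lebesgue"
        by (subst (asm) sets_restrict_space_iff) auto
      then show ?thesis
        by (intro sets.Int) auto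
    qed
    moreover have "{x \<in> space torus. h x > e} \<inter> {0..<2 * pi} = A"
      by (auto simp: A_def)
    ultimately have A: "A \<in> sets lebesgue"
      by simp
    have "emeasure lebesgue A = 0"
    proof (rule ccontr)
      assume nz: "emeasure lebesgue A \<noteq> 0"
      have "A \<in> lmeasurable"
        using A by (rule bounded_set_imp_lmeasurable[rotated]) (rule bounded_subset[of "{0..2 * pi}"], auto simp: A_def)
      then have pos: "0 < measure lebesgue A"
        using nz by (simp add: emeasure_eq_measure2 zero_less_measure_iff)
      \<comment> \<open>Taking the measure of \<open>A\<close> itself as the tolerance is what
        leaves \<open>K\<close> with positive measure.\<close>
      obtain K where K: "closed K" "K \<subseteq> A" "A - K \<in> lmeasurable" "emeasure lebesgue (A - K) < ennreal (measure lebesgue A)"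
        using sets_lebesgue_inner_closed[OF A pos] by blast
      have comp: "compact K"
      proof -
        have "bounded K"
          by (rule bounded_subset[of "{0..2 * pi}"]) (use K(2) in \<open>auto simp: A_def\<close>)
        with K(1) show ?thesis
          by (simp add: compact_eq_bounded_closed)
      qed
      then have Km: "K \<in> lmeasurable"
        by (rule lmeasurable_compact)
      have "measure lebesgue (A - K) < measure lebesgue A"
        using K(4) unfolding emeasure_eq_measure2[OF K(3)] by (subst (asm) ennreal_less_iff) auto
      then have Kpos: "0 < measure lebesgue K"
        using measure_Diff_null_set measurable_measure_Diff[OF \<open>A \<in> lmeasurable\<close> fmeasurableD[OF Km] K(2)] by simp
      then have "K \<noteq> {}"
        by auto
      have K_sub: "K \<subseteq> {0..<2 * pi}"
        using K(2) by (auto simp: A_def)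
      have Kt: "K \<in> sets torus" "K \<inter> space torus = K"
        using K_sub fmeasurableD[OF Km] by (auto simp: sets_restrict_space_iff)
      have fin: "emeasure torus K < \<infinity>"
        using Km K_sub by (subst emeasure_restrict_space) (auto simp: fmeasurable_def)
      have "(LINT x|torus. e * indicator K x) \<le> (LINT x|torus. h x * indicator K x)"
      proof (rule integral_mono)
        show "integrable torus (\<lambda>x. e * indicator K x)"
          using Kt fin by (intro integrable_mult_right integrable_real_indicator)
        show "integrable torus (\<lambda>x. h x * indicator K x)"
          using integrable_mult_indicator[OF Kt(1) h] by (simp add: mult.commute)
        show "e * indicator K x \<le> h x * indicator K x" for x
          using K(2) by (auto simp: A_def indicator_def)
      qed
      also have "\<dots> = 0"
        by (rule integral_compact_eq_0[OF h ortho comp K_sub \<open>K \<noteq> {}\<close>])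
      also have "(LINT x|torus. e * indicator K x) = e * measure lebesgue K"
      proof -
        have "measure torus K = measure lebesgue K"
          using K_sub by (intro measure_restrict_space) auto
        then show ?thesis
          using Kt by simp
      qed
      finally show False
        using e Kpos by (simp add: mult_le_0_iff)
    qed
    then have "A \<in> null_sets lebesgue"
      using A by (simp add: null_sets_def)
    then have "A \<union> {2 * pi} \<in> null_sets lebesgue"
      by (intro null_sets.Un) auto
    then have "AE x in lebesgue. x \<notin> A \<union> {2 * pi}"
      by (rule AE_not_in)
    then have "AE x in lebesgue. x \<in> {0..2 * pi} \<longrightarrow> h x \<le> e"
      by eventually_elim (auto simp: A_def not_less)
    then show ?thesis
      by (subst AE_restrict_space_iff) auto
  qed
  have "AE x in torus. \<forall>n. h x \<le> 1 / real (Suc n)"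
    unfolding AE_all_countable using * by auto
  then show ?thesis
  proof (rule AE_mp, intro AE_I2 impI)
    fix x assume "\<forall>n. h x \<le> 1 / real (Suc n)"
    then show "h x \<le> 0"
      by (intro LIMSEQ_le_const[OF LIMSEQ_inverse_real_of_nat]) (auto simp: inverse_eq_divide)
  qed
qed

lemma AE_zero_if_orthogonal_trigpoly:
  fixes h :: "real \<Rightarrow> real"
  assumes h: "integrable torus h" and ortho: "\<And>p. p \<in> trigpoly \<Longrightarrow> (LINT x|torus. h x * p x) = 0"
  shows "AE x in torus. h x = 0"
proof -
  have "AE x in torus. - h x \<le> 0"
    by (intro AE_nonpos_if_orthogonal_trigpoly) (simp_all add: h ortho)
  moreover have "AE x in torus. h x \<le> 0"
    by (intro AE_nonpos_if_orthogonal_trigpoly) (simp_all add: h ortho)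
  ultimately show ?thesis
    by eventually_elim simp
qed

section \<open>Anti-derivatives and weak derivatives\<close>

lemma set_integral_torus:
  fixes f :: "real \<Rightarrow> real"
  shows "(LINT x:{0..2 * pi}|lebesgue. f x) = (LINT x|torus. f x)"
  unfolding set_lebesgue_integral_def by (subst integral_restrict_space) auto

lemma integral_torus_HK:
  fixes f :: "real \<Rightarrow> real"
  shows "integrable torus f \<Longrightarrow> (LINT x|torus. f x) = integral {0..2 * pi} f"
  by (rule lebesgue_integral_eq_integral) auto

lemma absolutely_integrable_torus_iff:
  fixes f :: "real \<Rightarrow> real"
  shows "f absolutely_integrable_on {0..2 * pi} \<longleftrightarrow> integrable torus f"
  unfolding set_integrable_def by (subst integrable_restrict_space) auto

lemma square_int_const: "square_int (\<lambda>x. c)"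
  using finite_measure.integrable_const[OF finite_measure_lebesgue_on, of "{0..2 * pi}" "c\<^sup>2"]
  by (simp add: square_int_def)

lemma square_int_integrable: "square_int f \<Longrightarrow> integrable torus f"
  using square_int_mult[of f "\<lambda>x. 1"] square_int_const by simp

lemma square_int_continuous:
  assumes "continuous_on {0..2 * pi} f"
  shows "square_int f"
proof -
  have "continuous_on {0..2 * pi} (\<lambda>x. (f x)\<^sup>2)"
    using assms by (intro continuous_intros)
  then have "integrable torus (\<lambda>x. (f x)\<^sup>2)"
    unfolding absolutely_integrable_torus_iff[symmetric] by (rule absolutely_integrable_continuous_real)
  moreover have "f \<in> borel_measurable torus"
    using assms by (intro continuous_imp_measurable_on_sets_lebesgue) auto
  ultimately show ?thesis
    by (simp add: square_int_def)
qed

section \<open>Calculus with classes of functions and their means\<close>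

lemma to_L2_eqI:
  assumes "square_int f" "square_int g" "AE x in torus. f x = g x"
  shows "to_L2 f = to_L2 g"
  using Quotient_rel[OF Quotient_torus_L2, of f g] assms by (auto simp: L2_rel_def)

lemma add_to_L2:
  assumes "square_int f" "square_int g"
  shows "to_L2 f + to_L2 g = to_L2 (\<lambda>x. f x + g x)"
  using assms by (subst plus_torus_L2.abs_eq) (auto simp: L2_rel_def)

lemma scaleR_to_L2:
  assumes "square_int f"
  shows "c *\<^sub>R to_L2 f = to_L2 (\<lambda>x. c * f x)"
  using assms by (subst scaleR_torus_L2.abs_eq) (auto simp: L2_rel_def)

lemma torus_L2_cases:
  obtains f where "square_int f" "F = to_L2 f"
  using square_int_rep_L2[of F] to_L2_rep_L2[of F, symmetric] by blast

lemma inner_L2_rep_to_L2: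
  assumes "square_int g"
  shows "inner f (to_L2 g) = (1 / (2 * pi)) * (LINT x|torus. rep_L2 f x * g x)"
  using inner_to_L2[OF square_int_rep_L2 assms, of f] by (simp add: to_L2_rep_L2)

definition torus_mean :: "torus_L2 \<Rightarrow> real"
  where "torus_mean f = inner f (const_L2 1)"

lemma bounded_linear_torus_mean: "bounded_linear torus_mean"
  unfolding torus_mean_def by (rule bounded_linear_inner_left)

lemma torus_mean_diff: "torus_mean (f - g) = torus_mean f - torus_mean g"
  by (simp add: torus_mean_def inner_diff_left)

lemma const_L2_scaleR: "const_L2 c = c *\<^sub>R const_L2 1"
  by (simp add: const_L2_def scaleR_to_L2 square_int_const)

lemma torus_mean_to_L2:
  "square_int f \<Longrightarrow> torus_mean (to_L2 f) = (1 / (2 * pi)) * (LINT x|torus. f x)"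
  by (simp add: torus_mean_def const_L2_def inner_to_L2 square_int_const)

lemma torus_mean_rep: "torus_mean f = (1 / (2 * pi)) * (LINT x|torus. rep_L2 f x)"
  using torus_mean_to_L2[OF square_int_rep_L2, of f] by (simp add: to_L2_rep_L2)

lemma torus_mean_const: "torus_mean (const_L2 c) = c"
  by (simp add: const_L2_def torus_mean_to_L2 square_int_const measure_restrict_space)

lemma inner_const_L2: "inner f (const_L2 c) = c * torus_mean f"
  by (subst const_L2_scaleR) (simp add: torus_mean_def)

lemma antideriv_primitive:
  assumes "square_int f"
  shows "primitive_on 0 (2 * pi) (antideriv f) f" "antideriv f 0 + (LINT x|torus. f x) = antideriv f (2 * pi)"
    "(LINT x|torus. antideriv f x) = 0"
proof -
  have abs: "f absolutely_integrable_on {0..2 * pi}"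
    using square_int_integrable[OF assms] by (simp add: absolutely_integrable_torus_iff)
  have J: "(LINT y:{0..x}|lebesgue. f y) = integral {0..x} f" if "x \<in> {0..2 * pi}" for x
    using that by (intro set_lebesgue_integral_eq_integral(2) set_integrable_subset[OF abs]) auto
  define c where "c = (1 / (2 * pi)) * (LINT z:{0..2 * pi}|lebesgue. (LINT y:{0..z}|lebesgue. f y))"
  have anti: "antideriv f x = integral {0..x} f - c" if "x \<in> {0..2 * pi}" for x
    using J[OF that] by (simp add: antideriv_def c_def)
  show "primitive_on 0 (2 * pi) (antideriv f) f"
    unfolding primitive_on_def
  proof safe
    fix x assume x: "x \<in> {0..2 * pi}"
    have "f integrable_on {0..x}"
      using x set_integrable_subset[OF abs] by (intro set_lebesgue_integral_eq_integral(1)) auto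
    then show "(f has_integral antideriv f x - antideriv f 0) {0..x}"
      using anti[OF x] anti[of 0] by (simp add: integrable_integral)
  qed (fact abs)
  show "antideriv f 0 + (LINT x|torus. f x) = antideriv f (2 * pi)"
    using anti[of 0] anti[of "2 * pi"] by (simp add: integral_torus_HK square_int_integrable assms)
  have "continuous_on {0..2 * pi} (\<lambda>x. integral {0..x} f)"
    by (intro indefinite_integral_continuous_1 set_lebesgue_integral_eq_integral(1) abs)
  then have int: "integrable torus (\<lambda>x. integral {0..x} f)"
    by (intro square_int_integrable square_int_continuous)
  have "(LINT x|torus. antideriv f x) = (LINT x|torus. integral {0..x} f - c)"
    by (intro Bochner_Integration.integral_cong) (auto simp: anti)
  also have "\<dots> = (LINT x|torus. integral {0..x} f) - 2 * pi * c"
    using int square_int_integrable[OF square_int_const] by (simp add: measure_restrict_space)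
  also have "2 * pi * c = (LINT z|torus. (LINT y:{0..z}|lebesgue. f y))"
    by (simp add: c_def set_integral_torus)
  also have "\<dots> = (LINT x|torus. integral {0..x} f)"
    by (intro Bochner_Integration.integral_cong) (auto simp: J)
  finally show "(LINT x|torus. antideriv f x) = 0"
    by simp
qed

lemma continuous_on_antideriv: "square_int f \<Longrightarrow> continuous_on {0..2 * pi} (antideriv f)"
  by (rule primitive_on_continuous[OF antideriv_primitive(1)])

lemma square_int_antideriv: "square_int f \<Longrightarrow> square_int (antideriv f)"
  using square_int_continuous[OF continuous_on_antideriv] .

text \<open>Equal increments from \<open>0\<close> leave a constant difference, which zero mean
  forces to vanish. Linearity of the anti-derivative and its independence of representatives both
  come from this.\<close>

lemma antideriv_unique:
  assumes "square_int f" "continuous_on {0..2 * pi} F" "(LINT x|torus. F x) = 0"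
    and "\<And>x. x \<in> {0..2 * pi} \<Longrightarrow> F x - F 0 = antideriv f x - antideriv f 0" and x: "x \<in> {0..2 * pi}"
  shows "F x = antideriv f x"
proof -
  have int: "integrable torus (antideriv f)"
    using assms by (intro square_int_integrable square_int_antideriv)
  have "(LINT x|torus. F x) = (LINT x|torus. antideriv f x + (F 0 - antideriv f 0))"
  proof (intro Bochner_Integration.integral_cong refl)
    fix y assume "y \<in> space torus"
    then show "F y = antideriv f y + (F 0 - antideriv f 0)"
      using assms(4)[of y] by simp
  qed
  also have "\<dots> = 2 * pi * (F 0 - antideriv f 0)"
    using int square_int_integrable[OF square_int_const]
    by (simp add: antideriv_primitive(3) assms measure_restrict_space)
  finally show ?thesis
    using assms(3) assms(4)[OF x] by simp
qed

section \<open>The anti-derivative as a bounded operator\<close>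

definition antideriv_L2 :: "torus_L2 \<Rightarrow> torus_L2"
  where "antideriv_L2 f = to_L2 (antideriv (rep_L2 f))"

lemma inner_antideriv_L2:
  "(1 / (2 * pi)) * (LINT x:{0..2 * pi}|lebesgue. antideriv (rep_L2 f) x * rep_L2 g x) = inner (antideriv_L2 f) g"
  using inner_to_L2[OF square_int_antideriv[OF square_int_rep_L2] square_int_rep_L2, of f g]
  by (simp add: antideriv_L2_def to_L2_rep_L2 set_integral_torus)

lemma antideriv_diff_eq:
  assumes "square_int f" "x \<in> {0..2 * pi}"
  shows "antideriv f x - antideriv f 0 = integral {0..x} f" "f integrable_on {0..x}"
  using primitive_onD(3)[OF antideriv_primitive(1)[OF assms(1)] assms(2)] by (auto simp: integral_unique)

text \<open>Indefinite integrals do not see null sets, so any representative may be used.\<close>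

lemma antideriv_L2_to_L2:
  assumes "square_int f"
  shows "antideriv_L2 (to_L2 f) = to_L2 (antideriv f)"
proof -
  let ?g = "rep_L2 (to_L2 f)"
  have g: "square_int ?g"
    by (rule square_int_rep_L2)
  have "AE x in lebesgue. x \<in> {0..2 * pi} \<longrightarrow> ?g x = f x"
    using AE_rep_L2_to_L2[OF assms] by (subst (asm) AE_restrict_space_iff) auto
  then have N: "{x. \<not> (x \<in> {0..2 * pi} \<longrightarrow> ?g x = f x)} \<in> null_sets lebesgue"
    by (simp add: AE_iff_null_sets[symmetric] eventually_ae_filter completion.complete) (metis completion.complete2 null_sets_completion_iff)
  have "integral {0..x} ?g = integral {0..x} f" if "x \<in> {0..2 * pi}" for x
    using that by (intro integral_spike[OF N[unfolded negligible_iff_null_sets[symmetric]]]) auto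
  then have "antideriv ?g x = antideriv f x" if "x \<in> {0..2 * pi}" for x
    using that antideriv_diff_eq(1)[OF assms] antideriv_diff_eq(1)[OF g]
    by (intro antideriv_unique assms antideriv_primitive(3) continuous_on_antideriv g) auto
  then show ?thesis
    unfolding antideriv_L2_def
    by (intro to_L2_eqI square_int_antideriv assms g) auto
qed

lemma antideriv_L2_add: "antideriv_L2 (F + G) = antideriv_L2 F + antideriv_L2 G"
proof -
  obtain f g where f: "square_int f" "F = to_L2 f" and g: "square_int g" "G = to_L2 g"
    by (metis torus_L2_cases)
  note [simp] = antideriv_primitive(3)[OF f(1)] antideriv_primitive(3)[OF g(1)]
    square_int_integrable[OF square_int_antideriv[OF f(1)]] square_int_integrable[OF square_int_antideriv[OF g(1)]]
  have "antideriv f x + antideriv g x = antideriv (\<lambda>x. f x + g x) x" if "x \<in> {0..2 * pi}" for x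
  proof (rule antideriv_unique[OF square_int_add[OF f(1) g(1)] _ _ _ that])
    show "continuous_on {0..2 * pi} (\<lambda>x. antideriv f x + antideriv g x)"
      by (intro continuous_intros continuous_on_antideriv f g)
    show "antideriv f x + antideriv g x - (antideriv f 0 + antideriv g 0)
      = antideriv (\<lambda>x. f x + g x) x - antideriv (\<lambda>x. f x + g x) 0" if "x \<in> {0..2 * pi}" for x
      using antideriv_diff_eq[OF f(1) that] antideriv_diff_eq[OF g(1) that]
      by (simp add: antideriv_diff_eq(1)[OF square_int_add[OF f(1) g(1)] that]
          Henstock_Kurzweil_Integration.integral_add)
  qed simp
  then show ?thesis
    unfolding f(2) g(2) add_to_L2[OF f(1) g(1)] antideriv_L2_to_L2[OF square_int_add[OF f(1) g(1)]]
      antideriv_L2_to_L2[OF f(1)] antideriv_L2_to_L2[OF g(1)]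
      add_to_L2[OF square_int_antideriv[OF f(1)] square_int_antideriv[OF g(1)]]
    by (intro to_L2_eqI square_int_add square_int_antideriv f g) auto
qed

lemma antideriv_L2_scaleR: "antideriv_L2 (c *\<^sub>R F) = c *\<^sub>R antideriv_L2 F"
proof -
  obtain f where f: "square_int f" "F = to_L2 f"
    by (metis torus_L2_cases)
  note [simp] = antideriv_primitive(3)[OF f(1)]
  have "c * antideriv f x = antideriv (\<lambda>x. c * f x) x" if "x \<in> {0..2 * pi}" for x
  proof (rule antideriv_unique[OF square_int_scale[OF f(1)] _ _ _ that])
    show "continuous_on {0..2 * pi} (\<lambda>x. c * antideriv f x)"
      by (intro continuous_intros continuous_on_antideriv f)
    show "c * antideriv f x - c * antideriv f 0
      = antideriv (\<lambda>x. c * f x) x - antideriv (\<lambda>x. c * f x) 0" if "x \<in> {0..2 * pi}" for x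
      using antideriv_diff_eq[OF f(1) that]
      by (simp add: antideriv_diff_eq(1)[OF square_int_scale[OF f(1)] that] right_diff_distrib[symmetric])
  qed simp
  then show ?thesis
    unfolding f(2) scaleR_to_L2[OF f(1)] antideriv_L2_to_L2[OF square_int_scale[OF f(1)]]
      antideriv_L2_to_L2[OF f(1)] scaleR_to_L2[OF square_int_antideriv[OF f(1)]]
    by (intro to_L2_eqI square_int_scale square_int_antideriv f) auto
qed

text \<open>Wirtinger's inequality for the anti-derivative: zero mean of \<open>F\<close> makes it
  periodic, and its own mean vanishes by normalisation. The constant is 1 because the period is
  \<open>2 * pi\<close>.\<close>

lemma norm_antideriv_L2_le:
  assumes "torus_mean F = 0"
  shows "norm (antideriv_L2 F) \<le> norm F"
proof -
  obtain f where f: "square_int f" "F = to_L2 f"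
    by (metis torus_L2_cases)
  note sq = square_int_antideriv[OF f(1)]
  have int: "integrable torus (\<lambda>x. (f x)\<^sup>2)" "integrable torus (\<lambda>x. (antideriv f x)\<^sup>2)"
    using f(1) sq by (auto simp: square_int_def)
  have per: "antideriv f (2 * pi) = antideriv f 0"
    using antideriv_primitive(2)[OF f(1)] assms by (simp add: f torus_mean_to_L2)
  have "integral {0..2 * pi} (antideriv f) = 0"
    using antideriv_primitive(3)[OF f(1)] integral_torus_HK[OF square_int_integrable[OF sq]] by simp
  moreover have "(\<lambda>x. (f x)\<^sup>2) integrable_on {0..2 * pi}"
    using int(1) by (intro set_lebesgue_integral_eq_integral(1)) (simp add: absolutely_integrable_torus_iff)
  ultimately have "(LINT x|torus. (antideriv f x)\<^sup>2) \<le> (LINT x|torus. (f x)\<^sup>2)"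
    unfolding integral_torus_HK[OF int(1)] integral_torus_HK[OF int(2)]
    by (intro Wirtinger antideriv_primitive(1) f(1) per)
  then have "(norm (antideriv_L2 F))\<^sup>2 \<le> (norm F)\<^sup>2"
    by (simp add: f antideriv_L2_to_L2 norm_to_L2 sq divide_right_mono)
  then show ?thesis
    by (rule power2_le_imp_le) simp
qed

lemma torus_mean_antideriv_L2: "torus_mean (antideriv_L2 F) = 0"
  unfolding antideriv_L2_def
  by (simp add: torus_mean_to_L2 square_int_antideriv square_int_rep_L2 antideriv_primitive(3))

text \<open>Wirtinger controls the mean-free part, and the remaining part lies in the
  one-dimensional space of constants. The crude bound serves to make the energy differentiable on
  the whole space.\<close>

lemma bounded_linear_antideriv_L2: "bounded_linear antideriv_L2"
proof -
  define c d where "c = norm (const_L2 1)" and "d = norm (antideriv_L2 (const_L2 1))"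
  have "norm (antideriv_L2 F) \<le> norm F * (1 + c * c + c * d)" for F
  proof -
    define m where "m = \<bar>torus_mean F\<bar>"
    have "antideriv_L2 F = antideriv_L2 (F - const_L2 (torus_mean F)) + torus_mean F *\<^sub>R antideriv_L2 (const_L2 1)"
      unfolding antideriv_L2_scaleR[symmetric] antideriv_L2_add[symmetric] const_L2_scaleR[of "torus_mean F"] by simp
    then have "norm (antideriv_L2 F) \<le> norm (antideriv_L2 (F - const_L2 (torus_mean F))) + m * d"
      using norm_triangle_ineq[of "antideriv_L2 (F - const_L2 (torus_mean F))" "torus_mean F *\<^sub>R antideriv_L2 (const_L2 1)"]
      by (simp add: m_def d_def)
    also have "norm (antideriv_L2 (F - const_L2 (torus_mean F))) \<le> norm (F - const_L2 (torus_mean F))"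
      by (rule norm_antideriv_L2_le) (simp add: torus_mean_diff torus_mean_const)
    also have "\<dots> \<le> norm F + m * c"
      using norm_triangle_ineq4[of F "torus_mean F *\<^sub>R const_L2 1"]
      unfolding const_L2_scaleR[of "torus_mean F"] by (simp add: m_def c_def)
    finally have "norm (antideriv_L2 F) \<le> norm F + m * (c + d)"
      by (simp add: distrib_left)
    also have "m * (c + d) \<le> (norm F * c) * (c + d)"
      unfolding m_def torus_mean_def c_def d_def by (intro mult_right_mono Cauchy_Schwarz_ineq2) simp
    finally show ?thesis
      by (simp add: algebra_simps)
  qed
  then show ?thesis
    by (intro bounded_linear_intro[of antideriv_L2] antideriv_L2_add antideriv_L2_scaleR)
qed

lemma integral_by_parts_periodic:
  assumes F: "primitive_on 0 (2 * pi) F f" and G: "primitive_on 0 (2 * pi) G g"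
    and per: "F (2 * pi) * G (2 * pi) = F 0 * G 0"
  shows "(LINT x|torus. F x * g x) = - (LINT x|torus. f x * G x)"
proof -
  have int: "integrable torus (\<lambda>x. f x * G x)" "integrable torus (\<lambda>x. F x * g x)"
    using primitive_on_integrable_mult[OF F primitive_onD(1)[OF G]]
      primitive_on_integrable_mult[OF G primitive_onD(1)[OF F]]
    unfolding absolutely_integrable_torus_iff by (simp_all only: mult.commute)
  have "((\<lambda>x. f x * G x + F x * g x) has_integral 0) {0..2 * pi}"
    using primitive_onD(3)[OF primitive_on_mult[OF F G], of "2 * pi"] per by simp
  then have "(LINT x|torus. f x * G x + F x * g x) = 0"
    by (subst integral_torus_HK) (auto intro: int)
  then show ?thesis
    using int by simp
qed

text \<open>With zero means both anti-derivatives are periodic, so integration by parts has no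
  boundary term.\<close>

lemma inner_antideriv_L2_skew:
  assumes "torus_mean F = 0" "torus_mean G = 0"
  shows "inner (antideriv_L2 F) G = - inner F (antideriv_L2 G)"
proof -
  obtain f g where f: "square_int f" "F = to_L2 f" and g: "square_int g" "G = to_L2 g"
    by (metis torus_L2_cases)
  have "antideriv f (2 * pi) = antideriv f 0" "antideriv g (2 * pi) = antideriv g 0"
    using antideriv_primitive(2)[OF f(1)] antideriv_primitive(2)[OF g(1)] assms
    by (simp_all add: f g torus_mean_to_L2)
  then have "(LINT x|torus. antideriv f x * g x) = - (LINT x|torus. f x * antideriv g x)"
    by (intro integral_by_parts_periodic antideriv_primitive f g) simp
  then show ?thesis
    by (simp add: f g antideriv_L2_to_L2 inner_to_L2 square_int_antideriv)
qed

lemma trigpoly_continuous: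
  assumes "p \<in> trigpoly"
  shows "continuous_on S p"
  using trigpoly_deriv[OF assms] DERIV_isCont by (blast intro: continuous_at_imp_continuous_on)

lemma trigpoly_square_int: "p \<in> trigpoly \<Longrightarrow> square_int p"
  by (intro square_int_continuous trigpoly_continuous)

lemma eq_0_if_orthogonal_trigpoly:
  assumes "\<And>p. p \<in> trigpoly \<Longrightarrow> inner F (to_L2 p) = 0"
  shows "F = 0"
proof -
  obtain f where f: "square_int f" "F = to_L2 f"
    by (metis torus_L2_cases)
  have "AE x in torus. f x = 0"
  proof (rule AE_zero_if_orthogonal_trigpoly)
    show "(LINT x|torus. f x * p x) = 0" if "p \<in> trigpoly" for p
      using assms[OF that] by (simp add: f inner_to_L2 trigpoly_square_int that)
  qed (rule square_int_integrable[OF f(1)])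
  then show ?thesis
    unfolding f(2) zero_torus_L2_def
    by (intro to_L2_eqI f(1) square_int_zero)
qed

section \<open>Weak derivatives\<close>

lemma test_function_square_int:
  assumes "test_function \<phi>"
  shows "square_int \<phi>" "square_int (deriv \<phi>)"
proof -
  have "continuous_on {0..2 * pi} ((deriv ^^ n) \<phi>)" for n
    using assms unfolding test_function_def
    by (intro continuous_at_imp_continuous_on ballI field_differentiable_imp_continuous_at) auto
  from this[of 0] this[of 1] show "square_int \<phi>" "square_int (deriv \<phi>)"
    by (auto intro: square_int_continuous)
qed

lemma weak_deriv_iff_inner:
  "weak_deriv f g \<longleftrightarrow>
    (\<forall>\<phi>. test_function \<phi> \<longrightarrow> inner f (to_L2 (deriv \<phi>)) = - inner g (to_L2 \<phi>))"
proof -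
  have "1 / (2 * pi) * x = - (1 / (2 * pi) * y) \<longleftrightarrow> x = - y" for x y
    by (simp add: field_simps)
  then show ?thesis
    by (simp only: weak_deriv_def inner_L2_rep_to_L2 test_function_square_int cong: imp_cong)
qed

lemma weak_deriv_trigpoly:
  "weak_deriv f g \<Longrightarrow> p \<in> trigpoly \<Longrightarrow> inner f (to_L2 (deriv p)) = - inner g (to_L2 p)"
  by (simp add: weak_deriv_iff_inner trigpoly_test_function)

text \<open>The constant 1 is an admissible test function, because test functions are periodic
  rather than compactly supported in the open interval.\<close>

lemma weak_deriv_mean:
  assumes "weak_deriv f g"
  shows "torus_mean g = 0"
  using weak_deriv_trigpoly[OF assms trigpoly_const[of 1]] zero_torus_L2_def
  by (simp add: torus_mean_def const_L2_def)

lemma weak_deriv_unique: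
  assumes "weak_deriv f g" "weak_deriv f h"
  shows "g = h"
proof -
  have "g - h = 0"
    using weak_deriv_trigpoly[OF assms(1)] weak_deriv_trigpoly[OF assms(2)]
    by (intro eq_0_if_orthogonal_trigpoly) (simp add: inner_diff_left)
  then show ?thesis by simp
qed

lemma weak_deriv_scaleR:
  assumes "weak_deriv (c *\<^sub>R f) g" "c \<noteq> 0"
  shows "weak_deriv f ((1 / c) *\<^sub>R g)"
  using assms by (auto simp: weak_deriv_iff_inner field_simps)

text \<open>The difference of the two sides has mean 0 and is orthogonal to every
  \<open>deriv p\<close>: one part by definition of the weak derivative, the other by classical
  integration by parts. By \<open>trigpoly_primitive\<close> it is then orthogonal to all
  trigonometric polynomials.\<close>

lemma antideriv_L2_weak_deriv:
  assumes "weak_deriv f g"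
  shows "antideriv_L2 g = f - const_L2 (torus_mean f)"
proof -
  note mean = weak_deriv_mean[OF assms]
  define h where "h = f - const_L2 (torus_mean f) - antideriv_L2 g"
  have h_mean: "torus_mean h = 0"
    by (simp add: h_def torus_mean_diff torus_mean_const torus_mean_antideriv_L2)
  have deriv_mean: "torus_mean (to_L2 (deriv p)) = 0"
    and parts: "inner (antideriv_L2 g) (to_L2 (deriv p)) = - inner g (to_L2 p)" if p: "p \<in> trigpoly" for p
  proof -
    have dp: "square_int (deriv p)" and sp: "square_int p"
      using trigpoly_deriv[OF p] p by (auto intro: trigpoly_square_int)
    have p_prim: "primitive_on 0 (2 * pi) p (deriv p)"
      using trigpoly_deriv[OF p] by (intro primitive_on_C1 trigpoly_continuous) auto
    have p_per: "p (2 * pi) = p 0"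
      using trigpoly_periodic[OF p, of 0] by simp
    have one: "primitive_on 0 (2 * pi) (\<lambda>x. 1) (\<lambda>x. 0)"
      by (intro primitive_on_C1) auto
    show "torus_mean (to_L2 (deriv p)) = 0"
      using integral_by_parts_periodic[OF one p_prim] p_per by (simp add: torus_mean_to_L2 dp)
    obtain k where k: "square_int k" "g = to_L2 k"
      by (metis torus_L2_cases)
    have "antideriv k (2 * pi) = antideriv k 0"
      using antideriv_primitive(2)[OF k(1)] mean by (simp add: k torus_mean_to_L2)
    then have "(LINT x|torus. antideriv k x * deriv p x) = - (LINT x|torus. k x * p x)"
      by (intro integral_by_parts_periodic antideriv_primitive k p_prim) (simp add: p_per)
    then show "inner (antideriv_L2 g) (to_L2 (deriv p)) = - inner g (to_L2 p)"
      by (simp add: k antideriv_L2_to_L2 inner_to_L2 square_int_antideriv sp dp)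
  qed
  have "inner h (to_L2 p) = 0" if p: "p \<in> trigpoly" for p
  proof -
    obtain c q where q: "q \<in> trigpoly" "\<And>x. p x = c + deriv q x"
      using trigpoly_primitive[OF p] by blast
    have dq: "square_int (deriv q)"
      using trigpoly_deriv[OF q(1)] by (auto intro: trigpoly_square_int)
    have "p = (\<lambda>x. c + deriv q x)"
      using q(2) by blast
    then have "to_L2 p = const_L2 c + to_L2 (deriv q)"
      by (simp add: const_L2_def add_to_L2 square_int_const dq)
    moreover have "inner h (to_L2 (deriv q)) = 0"
      using weak_deriv_trigpoly[OF assms q(1)] parts[OF q(1)] deriv_mean[OF q(1)]
      by (simp add: h_def inner_diff_left inner_const_L2 inner_commute[of "const_L2 _"])
    ultimately show ?thesis
      by (simp add: inner_add_right inner_const_L2 h_mean)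
  qed
  then have "h = 0"
    by (rule eq_0_if_orthogonal_trigpoly)
  then show ?thesis
    by (simp add: h_def)
qed

text \<open>Up to constants, \<open>f\<close> and \<open>g\<close> are the anti-derivatives of
  \<open>f'\<close> and \<open>g'\<close>. The constants are invisible to mean-free partners, so
  skew-symmetry of the anti-derivative carries over.\<close>

lemma weak_deriv_skew:
  assumes "weak_deriv f f'" "weak_deriv g g'"
  shows "inner f' g = - inner f g'"
proof -
  note mean = weak_deriv_mean[OF assms(1)] weak_deriv_mean[OF assms(2)]
  have f: "f = antideriv_L2 f' + const_L2 (torus_mean f)" and g: "g = antideriv_L2 g' + const_L2 (torus_mean g)"
    by (simp_all add: antideriv_L2_weak_deriv[OF assms(1)] antideriv_L2_weak_deriv[OF assms(2)])
  have "inner f' g = inner f' (antideriv_L2 g')"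
    by (subst g) (simp add: inner_add_right inner_const_L2 mean)
  moreover have "inner f g' = inner (antideriv_L2 f') g'"
    by (subst f) (simp add: inner_add_left inner_const_L2 mean inner_commute[of "const_L2 _"])
  ultimately show ?thesis
    using inner_antideriv_L2_skew[OF mean] by simp
qed

section \<open>Lyapunov functionals of mild solutions\<close>

lemma C0_semigroupD:
  assumes "C0_semigroup T"
  shows "t \<ge> 0 \<Longrightarrow> bounded_linear (T t)" "T 0 x = x" "s \<ge> 0 \<Longrightarrow> t \<ge> 0 \<Longrightarrow> T (s + t) x = T s (T t x)"
  using assms by (auto simp: C0_semigroup_def)

lemma integral_average_has_vector_derivative:
  fixes u :: "real \<Rightarrow> 'a :: banach"
  assumes u: "continuous_on {0..} u" and "0 \<le> t" "0 \<le> h"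
  shows "((\<lambda>t. integral {t..t + h} u) has_vector_derivative u (t + h) - u t) (at t within {0..})"
proof -
  have int: "u integrable_on {a..b}" if "0 \<le> a" for a b
    using that by (intro integrable_continuous_real continuous_on_subset[OF u]) auto
  have I: "((\<lambda>x. integral {0..x} u) has_vector_derivative u x) (at x within {0..})" if "0 \<le> x" for x
  proof -
    have "((\<lambda>x. integral {0..x} u) has_vector_derivative u x) (at x within {0..x + 1})"
      using that by (intro integral_has_vector_derivative continuous_on_subset[OF u]) auto
    moreover have "at x within {0..x + 1} = at x within {0..}"
      by (rule at_within_nhd[of _ "{..<x + 1}"]) auto
    ultimately show ?thesis by simp
  qed
  have "((\<lambda>t. t + h) has_vector_derivative 1) (at t within {0..})"
    by (auto intro!: derivative_eq_intros)
  moreover have "((\<lambda>x. integral {0..x} u) has_vector_derivative u (t + h)) (at (t + h) within (\<lambda>t. t + h) ` {0..})"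
    using assms by (intro has_vector_derivative_within_subset[OF I]) auto
  ultimately have "(((\<lambda>x. integral {0..x} u) \<circ> (\<lambda>t. t + h)) has_vector_derivative 1 *\<^sub>R u (t + h)) (at t within {0..})"
    by (rule vector_diff_chain_within)
  then have "((\<lambda>t. integral {0..t + h} u - integral {0..t} u) has_vector_derivative u (t + h) - u t) (at t within {0..})"
    using I[OF assms(2)] by (intro has_vector_derivative_diff) (auto simp: o_def)
  then show ?thesis
  proof (rule has_vector_derivative_transform[rotated 2])
    fix s :: real assume "s \<in> {0..}"
    then show "integral {s..s + h} u = integral {0..s + h} u - integral {0..s} u"
      using Henstock_Kurzweil_Integration.integral_combine[of 0 s "s + h" u] int[of 0] assms by (simp add: algebra_simps)
  qed (use assms in auto)
qed

lemma has_vector_derivative_right_quotient: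
  assumes "(f has_vector_derivative y) (at_right x)"
  shows "((\<lambda>h. (1 / h) *\<^sub>R (f (x + h) - f x)) \<longlongrightarrow> y) (at_right 0)"
proof -
  have "((\<lambda>z. (1 / norm (z - x)) *\<^sub>R (f z - (f x + (z - x) *\<^sub>R y))) \<longlongrightarrow> 0) (at_right x)"
    using assms by (simp add: has_vector_derivative_def has_derivative_within)
  then have "((\<lambda>h. (1 / norm h) *\<^sub>R (f (h + x) - (f x + h *\<^sub>R y))) \<longlongrightarrow> 0) (at_right 0)"
    by (subst (asm) filterlim_at_right_to_0) simp
  then have "((\<lambda>h. (1 / norm h) *\<^sub>R (f (h + x) - (f x + h *\<^sub>R y)) + y) \<longlongrightarrow> 0 + y) (at_right 0)"
    by (intro tendsto_add tendsto_const)
  moreover have "\<forall>\<^sub>F h in at_right 0. (1 / norm h) *\<^sub>R (f (h + x) - (f x + h *\<^sub>R y)) + y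
      = (1 / h) *\<^sub>R (f (x + h) - f x)"
    using eventually_at_right_less[of 0]
  proof eventually_elim
    case (elim h)
    then show ?case
      by (simp add: scaleR_diff_right scaleR_add_right add.commute)
  qed
  ultimately show ?thesis
    by (rule_tac Lim_transform_eventually) simp_all
qed

lemma integral_average_tendsto:
  fixes u :: "real \<Rightarrow> 'a :: banach"
  assumes u: "continuous_on {0..} u" and "0 \<le> t"
  shows "((\<lambda>h. (1 / h) *\<^sub>R integral {t..t + h} u) \<longlongrightarrow> u t) (at_right 0)"
proof -
  have "((\<lambda>x. integral {t..x} u) has_vector_derivative u t) (at t within {t..t + 1})"
    using assms by (intro integral_has_vector_derivative continuous_on_subset[OF u]) auto
  moreover have "at t within {t..t + 1} = at_right t"
    by (simp add: at_within_Icc_at_right)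
  ultimately show ?thesis
    using has_vector_derivative_right_quotient[of "\<lambda>x. integral {t..x} u" "u t" t] by simp
qed

text \<open>Averaging over a short time interval regularises a mild solution into one that stays in the
  domain of the generator; this replaces the density of the domain.\<close>

lemma generator_integral_average:
  assumes T: "C0_semigroup T" and u: "continuous_on {0..} u" "\<And>s. 0 \<le> s \<Longrightarrow> u s = T s u0"
    and t: "0 \<le> t" and h: "0 < h"
  shows "((1 / h) *\<^sub>R integral {t..t + h} u, (1 / h) *\<^sub>R (u (t + h) - u t)) \<in> generator T"
proof -
  define U where "U t = (1 / h) *\<^sub>R integral {t..t + h} u" for t
  have int: "u integrable_on {a..b}" if "0 \<le> a" for a b
    using that by (intro integrable_continuous_real continuous_on_subset[OF u(1)]) auto
  \<comment> \<open>The bounded operator \<open>T s\<close> moves inside the time integral, where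
    the semigroup law turns it into a time shift. The quotient defining the generator thus becomes
    the right time derivative of \<open>U\<close>.\<close>
  have shift: "T s (U t) = U (t + s)" if s: "0 \<le> s" for s
  proof -
    interpret bounded_linear "T s"
      by (rule C0_semigroupD(1)[OF T s])
    have "T s (integral {t..t + h} u) = integral {t..t + h} (T s \<circ> u)"
      by (rule integral_linear[symmetric, OF int[OF t] bounded_linear_axioms])
    also have "\<dots> = integral {t..t + h} (u \<circ> (\<lambda>x. x + s))"
      using s t by (intro Henstock_Kurzweil_Integration.integral_cong)
        (simp add: u(2) C0_semigroupD(3)[OF T, symmetric] add.commute)
    also have "\<dots> = integral {t + s..t + h + s} u"
      using integral_shift_real_ivl[of "t + s" s "t + h + s" u] by (simp add: o_def)
    finally show ?thesis
      by (simp add: U_def scaleR add_ac)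
  qed
  have "(U has_vector_derivative (1 / h) *\<^sub>R (u (t + h) - u t)) (at t within {0..})"
    unfolding U_def using integral_average_has_vector_derivative[OF u(1) t, of h] h
    by (intro bounded_linear.has_vector_derivative[OF bounded_linear_scaleR_right]) auto
  then have "((\<lambda>s. (1 / s) *\<^sub>R (U (t + s) - U t)) \<longlongrightarrow> (1 / h) *\<^sub>R (u (t + h) - u t)) (at_right 0)"
    using t by (intro has_vector_derivative_right_quotient) (auto intro: has_vector_derivative_within_subset)
  moreover have "\<forall>\<^sub>F s in at_right 0. (1 / s) *\<^sub>R (U (t + s) - U t) = (1 / s) *\<^sub>R (T s (U t) - U t)"
    using eventually_at_right_less[of 0] by eventually_elim (simp add: shift)
  ultimately show ?thesis
    unfolding generator_def U_def[symmetric] by (auto intro: Lim_transform_eventually)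
qed

text \<open>For the averaged solution, \<open>exp (\<alpha> * s) * E\<close> is differentiable with
  nonpositive derivative by \<open>diss\<close>; continuity of \<open>E\<close> then lets the
  averaging width tend to 0. With rate 0 and linear \<open>E\<close> the lemma also yields
  conservation laws.\<close>

lemma mild_solution_Lyapunov:
  fixes E :: "'a :: banach \<Rightarrow> real"
  assumes "mild_solution A u0 u" "continuous_on {0..} u" "0 \<le> t"
    and E: "\<And>x. (E has_derivative E' x) (at x)"
    and diss: "\<And>x y. (x, y) \<in> A \<Longrightarrow> E' x y + \<alpha> * E x \<le> 0"
  shows "E (u t) \<le> E u0 * exp (- \<alpha> * t)"
proof -
  obtain T where T: "C0_semigroup T" "generator T = A" "\<And>s. 0 \<le> s \<Longrightarrow> u s = T s u0"
    using assms(1) by (auto simp: mild_solution_def)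
  define U where "U h t = (1 / h) *\<^sub>R integral {t..t + h} u" for h t
  have u0: "u 0 = u0"
    using T(3)[of 0] C0_semigroupD(2)[OF T(1)] by simp
  have step: "exp (\<alpha> * t) * E (U h t) \<le> E (U h 0)" if h: "0 < h" for h
  proof -
    define \<Phi> where "\<Phi> s = exp (\<alpha> * s) * E (U h s)" for s
    define U' where "U' s = (1 / h) *\<^sub>R (u (s + h) - u s)" for s
    have U: "(U h has_vector_derivative U' s) (at s within {0..})" if "0 \<le> s" for s
      unfolding U_def U'_def using integral_average_has_vector_derivative[OF assms(2) that, of h] h
      by (intro bounded_linear.has_vector_derivative[OF bounded_linear_scaleR_right]) auto
    have \<Phi>: "(\<Phi> has_real_derivative exp (\<alpha> * s) * (E' (U h s) (U' s) + \<alpha> * E (U h s))) (at s within {0..})"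
      if s: "0 \<le> s" for s
    proof -
      interpret E': bounded_linear "E' (U h s)"
        using E by (rule has_derivative_bounded_linear)
      have "((\<lambda>s. E (U h s)) has_vector_derivative E' (U h s) (U' s)) (at s within {0..})"
        using has_derivative_compose[OF U[OF s, unfolded has_vector_derivative_def] E]
        by (simp add: has_vector_derivative_def E'.scaleR)
      then have "((\<lambda>s. E (U h s)) has_real_derivative E' (U h s) (U' s)) (at s within {0..})"
        by (simp add: has_real_derivative_iff_has_vector_derivative)
      then show ?thesis
        unfolding \<Phi>_def by (auto intro!: derivative_eq_intros simp: algebra_simps)
    qed
    have "\<Phi> t \<le> \<Phi> 0"
    proof (rule DERIV_nonpos_imp_decreasing_open[OF assms(3)])
      fix s :: real assume s: "0 < s" "s < t"
      have "(U h s, U' s) \<in> A"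
        using generator_integral_average[OF T(1) assms(2) T(3), of s h] s h by (simp add: T(2) U_def U'_def)
      from diss[OF this] have "exp (\<alpha> * s) * (E' (U h s) (U' s) + \<alpha> * E (U h s)) \<le> 0"
        by (simp add: mult_nonneg_nonpos)
      moreover have "at s within {0..} = at s"
        using s by (intro at_within_interior) (simp add: interior_real_atLeast)
      ultimately show "\<exists>y. (\<Phi> has_real_derivative y) (at s) \<and> y \<le> 0"
        using \<Phi>[of s] s by auto
    next
      show "continuous_on {0..t} \<Phi>"
        using \<Phi> DERIV_subset[of \<Phi> _ _ "{0..}" "{0..t}"] by (intro DERIV_continuous_on) auto
    qed
    then show ?thesis
      by (simp add: \<Phi>_def)
  qed
  have lim: "((\<lambda>h. E (U h s)) \<longlongrightarrow> E (u s)) (at_right 0)" if "0 \<le> s" for s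
    unfolding U_def
    by (rule isCont_tendsto_compose[OF has_derivative_continuous[OF E] integral_average_tendsto[OF assms(2) that]])
  have "exp (\<alpha> * t) * E (u t) \<le> E (u 0)"
  proof (rule tendsto_le[OF _ lim tendsto_mult[OF tendsto_const lim]])
    show "\<forall>\<^sub>F h in at_right 0. exp (\<alpha> * t) * E (U h t) \<le> E (U h 0)"
      using eventually_at_right_less[of 0] by eventually_elim (rule step)
  qed (use assms(3) in auto)
  then show ?thesis
    by (simp add: u0 exp_minus field_simps)
qed

section \<open>Dissipation for the Goldstein-Taylor operator\<close>

lemma square_int_mult_bounded:
  assumes "square_int f" "\<sigma> \<in> borel_measurable torus" "AE x in torus. \<bar>\<sigma> x\<bar> \<le> B"
  shows "square_int (\<lambda>x. \<sigma> x * f x)"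
  unfolding square_int_def
proof
  have f: "f \<in> borel_measurable torus" "integrable torus (\<lambda>x. (f x)\<^sup>2)"
    using assms(1) by (auto simp: square_int_def)
  show m: "(\<lambda>x. \<sigma> x * f x) \<in> borel_measurable torus"
    using assms(2) f(1) by (rule borel_measurable_times)
  show "integrable torus (\<lambda>x. (\<sigma> x * f x)\<^sup>2)"
  proof (rule Bochner_Integration.integrable_bound[OF integrable_mult_right[OF f(2), of "B\<^sup>2"]])
    show "(\<lambda>x. (\<sigma> x * f x)\<^sup>2) \<in> borel_measurable torus"
      using m by (rule borel_measurable_power)
    show "AE x in torus. norm ((\<sigma> x * f x)\<^sup>2) \<le> norm (B\<^sup>2 * (f x)\<^sup>2)"
      using assms(3)
    proof eventually_elim
      case (elim x)
      then have "(\<sigma> x)\<^sup>2 \<le> B\<^sup>2"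
        by (simp add: abs_le_square_iff[symmetric])
      then show ?case
        by (simp add: power_mult_distrib mult_right_mono)
    qed
  qed
qed

text \<open>The left-hand side, as a function of \<open>g\<close>, is largest at
  \<open>g = e * p / (2 * d)\<close>, with value \<open>e^2 / (4 * d) * p^2\<close>.\<close>

lemma quadratic_form_bound:
  fixes d e p g s :: real
  assumes "0 < d" "e\<^sup>2 / (4 * d) \<le> s"
  shows "e * p * g - d * g\<^sup>2 \<le> s * p\<^sup>2"
proof -
  have "0 \<le> d * (g - e * p / (2 * d))\<^sup>2"
    using assms by simp
  also have "\<dots> = d * g\<^sup>2 - e * p * g + e\<^sup>2 / (4 * d) * p\<^sup>2"
    using assms(1) by (simp add: power2_eq_square field_simps)
  finally have "e * p * g - d * g\<^sup>2 \<le> e\<^sup>2 / (4 * d) * p\<^sup>2"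
    by simp
  also have "\<dots> \<le> s * p\<^sup>2"
    using assms(2) by (rule mult_right_mono) simp
  finally show ?thesis .
qed

text \<open>The assumptions on the parameters in almost-everywhere form, with real bounds in place
  of extended-real suprema. The sign of \<open>S\<^sub>1\<close> is recorded because a bound on
  \<open>norm P\<close> is later multiplied by it.\<close>

locale GT_parameters =
  fixes \<sigma> :: "real \<Rightarrow> real" and \<theta> \<alpha> S\<^sub>1 S\<^sub>2 B :: real
  assumes \<sigma>_meas: "\<sigma> \<in> borel_measurable torus" and \<sigma>_bounded: "AE x in torus. \<bar>\<sigma> x\<bar> \<le> B"
    and \<theta>: "0 < \<theta>"
    and \<sigma>_lower: "AE x in torus. sqrt (2 / 3) * \<theta> + \<alpha> < 2 * \<sigma> x"
    and S\<^sub>1: "AE x in torus. \<theta>\<^sup>2 * (\<sigma> x - \<alpha>)\<^sup>2 / (8 * \<sigma> x - 4 * sqrt (2 / 3) * \<theta> - 4 * \<alpha>) \<le> S\<^sub>1"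
    and S\<^sub>2: "AE x in torus. \<theta>\<^sup>2 / (12 * (2 * \<sigma> x - \<alpha>)) \<le> S\<^sub>2"
    and S\<^sub>1_nonneg: "0 \<le> S\<^sub>1"
    and S_sum: "S\<^sub>1 + S\<^sub>2 \<le> sqrt (2 / 3) * \<theta> - \<alpha>"
begin

lemma square_int_\<sigma>: "square_int f \<Longrightarrow> square_int (\<lambda>x. \<sigma> x * f x)"
  using square_int_mult_bounded \<sigma>_meas \<sigma>_bounded by blast

lemma mult_L2_to_L2:
  assumes "square_int f"
  shows "mult_L2 \<sigma> (to_L2 f) = to_L2 (\<lambda>x. \<sigma> x * f x)"
  unfolding mult_L2_def using AE_rep_L2_to_L2[OF assms]
  by (intro to_L2_eqI square_int_\<sigma> square_int_rep_L2 assms) (auto elim: eventually_mono)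

text \<open>Here \<open>g\<close>, \<open>h\<close>, \<open>w\<close>, \<open>p\<close> stand for
  \<open>u2\<close>, \<open>u3\<close>, \<open>w\<close>, \<open>P w\<close>. The bound adds two
  completed squares: in \<open>g\<close> with
  \<open>d = 2\<sigma> - sqrt (2/3) \<theta> - \<alpha>\<close> and
  \<open>e = \<theta> (\<sigma> - \<alpha>)\<close>, in \<open>h\<close> with
  \<open>d = 2\<sigma> - \<alpha>\<close> and \<open>e = - \<theta> / sqrt 3\<close>. The
  denominators of the theorem are \<open>4 d\<close>, and the 12 is 4 times the 3 from
  \<open>e^2\<close>.\<close>

lemma integrand_bound:
  "AE x in torus. - 2 * (\<sigma> x * g x * g x) - 2 * (\<sigma> x * h x * h x) + (sqrt (2 / 3) * \<theta> + \<alpha>) * (g x * g x)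
      + \<alpha> * (h x * h x) - \<theta> / sqrt 3 * (w x * h x) + \<theta> * (\<sigma> x * g x * p x) - \<theta> * \<alpha> * (p x * g x)
    \<le> S\<^sub>1 * (p x * p x) + S\<^sub>2 * (w x * w x)"
  using \<sigma>_lower S\<^sub>1 S\<^sub>2
proof eventually_elim
  case (elim x)
  have d: "0 < 2 * \<sigma> x - sqrt (2 / 3) * \<theta> - \<alpha>"
    using elim(1) by simp
  moreover have "0 < sqrt (2 / 3) * \<theta>"
    using \<theta> by simp
  ultimately have d': "0 < 2 * \<sigma> x - \<alpha>"
    by simp
  have "(\<theta> * (\<sigma> x - \<alpha>))\<^sup>2 / (4 * (2 * \<sigma> x - sqrt (2 / 3) * \<theta> - \<alpha>)) \<le> S\<^sub>1"
    using elim(2) by (simp add: power_mult_distrib right_diff_distrib[of 4] mult.assoc)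
  from quadratic_form_bound[OF d this, of "p x" "g x"]
  have 1: "\<theta> * (\<sigma> x - \<alpha>) * p x * g x - (2 * \<sigma> x - sqrt (2 / 3) * \<theta> - \<alpha>) * (g x)\<^sup>2 \<le> S\<^sub>1 * (p x)\<^sup>2" .
  have "(- \<theta> / sqrt 3)\<^sup>2 / (4 * (2 * \<sigma> x - \<alpha>)) \<le> S\<^sub>2"
    using elim(3) by (simp add: power_divide)
  from quadratic_form_bound[OF d' this, of "w x" "h x"]
  have 2: "- \<theta> / sqrt 3 * w x * h x - (2 * \<sigma> x - \<alpha>) * (h x)\<^sup>2 \<le> S\<^sub>2 * (w x)\<^sup>2" .
  show ?case
    using add_mono[OF 1 2] by (simp add: power2_eq_square algebra_simps)
qed

text \<open>After integrating the pointwise bound, the term \<open>S\<^sub>1 * inner P P\<close> is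
  traded for \<open>S\<^sub>1 * inner W W\<close>, so that both suprema multiply the same norm and
  \<open>S_sum\<close> applies.\<close>

lemma form_bound:
  assumes "norm P \<le> norm W"
  shows "- 2 * inner (mult_L2 \<sigma> G) G - 2 * inner (mult_L2 \<sigma> H) H + (sqrt (2 / 3) * \<theta> + \<alpha>) * inner G G
      + \<alpha> * inner H H - \<theta> / sqrt 3 * inner W H + \<theta> * inner (mult_L2 \<sigma> G) P - \<theta> * \<alpha> * inner P G
    \<le> (sqrt (2 / 3) * \<theta> - \<alpha>) * inner W W"
proof -
  obtain g h w p where sq: "square_int g" "square_int h" "square_int w" "square_int p"
    and eq: "G = to_L2 g" "H = to_L2 h" "W = to_L2 w" "P = to_L2 p"
    by (metis torus_L2_cases)
  note sq' = sq square_int_\<sigma>[OF sq(1)] square_int_\<sigma>[OF sq(2)]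
  note [simp] = square_int_mult[OF sq'(5) sq(1)] square_int_mult[OF sq'(6) sq(2)]
    square_int_mult[OF sq(1) sq(1)] square_int_mult[OF sq(2) sq(2)] square_int_mult[OF sq(3) sq(2)]
    square_int_mult[OF sq'(5) sq(4)] square_int_mult[OF sq(4) sq(1)]
    square_int_mult[OF sq(4) sq(4)] square_int_mult[OF sq(3) sq(3)]
  have "(LINT x|torus. - 2 * (\<sigma> x * g x * g x) - 2 * (\<sigma> x * h x * h x) + (sqrt (2 / 3) * \<theta> + \<alpha>) * (g x * g x)
      + \<alpha> * (h x * h x) - \<theta> / sqrt 3 * (w x * h x) + \<theta> * (\<sigma> x * g x * p x) - \<theta> * \<alpha> * (p x * g x))
    \<le> (LINT x|torus. S\<^sub>1 * (p x * p x) + S\<^sub>2 * (w x * w x))"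
    by (intro integral_mono_AE integrand_bound Bochner_Integration.integrable_add
        Bochner_Integration.integrable_diff integrable_mult_right) simp_all
  then have "- 2 * (LINT x|torus. \<sigma> x * g x * g x) - 2 * (LINT x|torus. \<sigma> x * h x * h x)
      + (sqrt (2 / 3) * \<theta> + \<alpha>) * (LINT x|torus. g x * g x) + \<alpha> * (LINT x|torus. h x * h x)
      - \<theta> / sqrt 3 * (LINT x|torus. w x * h x) + \<theta> * (LINT x|torus. \<sigma> x * g x * p x)
      - \<theta> * \<alpha> * (LINT x|torus. p x * g x)
    \<le> S\<^sub>1 * (LINT x|torus. p x * p x) + S\<^sub>2 * (LINT x|torus. w x * w x)"
    by simp
  from mult_left_mono[OF this, of "1 / (2 * pi)"]
  have "- 2 * inner (mult_L2 \<sigma> G) G - 2 * inner (mult_L2 \<sigma> H) H + (sqrt (2 / 3) * \<theta> + \<alpha>) * inner G G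
      + \<alpha> * inner H H - \<theta> / sqrt 3 * inner W H + \<theta> * inner (mult_L2 \<sigma> G) P - \<theta> * \<alpha> * inner P G
    \<le> S\<^sub>1 * inner P P + S\<^sub>2 * inner W W"
    unfolding eq mult_L2_to_L2[OF sq(1)] mult_L2_to_L2[OF sq(2)]
      inner_to_L2[OF sq'(5) sq(1)] inner_to_L2[OF sq'(6) sq(2)]
      inner_to_L2[OF sq(1) sq(1)] inner_to_L2[OF sq(2) sq(2)] inner_to_L2[OF sq(3) sq(2)]
      inner_to_L2[OF sq'(5) sq(4)] inner_to_L2[OF sq(4) sq(1)]
      inner_to_L2[OF sq(4) sq(4)] inner_to_L2[OF sq(3) sq(3)]
    by (simp add: algebra_simps add_divide_distrib diff_divide_distrib)
  also have "S\<^sub>1 * inner P P \<le> S\<^sub>1 * inner W W"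
    using assms S\<^sub>1_nonneg by (intro mult_left_mono) (simp_all add: norm_le)
  also have "S\<^sub>1 * inner W W + S\<^sub>2 * inner W W \<le> (sqrt (2 / 3) * \<theta> - \<alpha>) * inner W W"
    using S_sum by (simp add: distrib_right[symmetric] mult_right_mono)
  finally show ?thesis
    by simp
qed

text \<open>The second claim is the derivative of the energy in direction \<open>V\<close> plus
  \<open>\<alpha>\<close> times the energy. Skew-symmetry is applied only to the pair
  \<open>U\<^sub>2\<close> and \<open>Z\<close>, the one combination of \<open>U\<^sub>1\<close> and
  \<open>U\<^sub>3\<close> that the domain makes differentiable.\<close>

lemma dissipation:
  assumes "((U\<^sub>1, U\<^sub>2, U\<^sub>3), (V\<^sub>1, V\<^sub>2, V\<^sub>3)) \<in> GT_operator \<sigma>"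
  defines "W \<equiv> U\<^sub>1 - const_L2 (torus_mean U\<^sub>1)"
  shows "torus_mean V\<^sub>1 = 0"
    and "2 * inner W V\<^sub>1 + 2 * inner U\<^sub>2 V\<^sub>2 + 2 * inner U\<^sub>3 V\<^sub>3
      - \<theta> * (inner (antideriv_L2 V\<^sub>1) U\<^sub>2 + inner (antideriv_L2 W) V\<^sub>2)
      + \<alpha> * (inner W W + inner U\<^sub>2 U\<^sub>2 + inner U\<^sub>3 U\<^sub>3 - \<theta> * inner (antideriv_L2 W) U\<^sub>2) \<le> 0"
proof -
  define a b :: real where "a = sqrt (2 / 3)" and "b = 1 / sqrt 3"
  define N\<^sub>2 N\<^sub>3 where "N\<^sub>2 = mult_L2 \<sigma> U\<^sub>2" and "N\<^sub>3 = mult_L2 \<sigma> U\<^sub>3"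
  define Z where "Z = a *\<^sub>R U\<^sub>1 + b *\<^sub>R U\<^sub>3"
  have "a \<noteq> 0" "b \<noteq> 0"
    by (simp_all add: a_def b_def)
  have d1: "weak_deriv (a *\<^sub>R U\<^sub>2) (- V\<^sub>1)" and d2: "weak_deriv Z (- V\<^sub>2 - N\<^sub>2)"
    and d3: "weak_deriv (b *\<^sub>R U\<^sub>2) (- V\<^sub>3 - N\<^sub>3)"
    using assms(1) by (simp_all add: GT_operator_def a_def b_def Z_def N\<^sub>2_def N\<^sub>3_def)
  define D where "D = (1 / a) *\<^sub>R (- V\<^sub>1)"
  have D: "weak_deriv U\<^sub>2 D"
    unfolding D_def by (rule weak_deriv_scaleR[OF d1 \<open>a \<noteq> 0\<close>])
  \<comment> \<open>The first and third equations both prescribe the weak derivative of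
    \<open>U\<^sub>2\<close>; uniqueness identifies the two as a single \<open>D\<close>.\<close>
  have "weak_deriv U\<^sub>2 ((1 / b) *\<^sub>R (- V\<^sub>3 - N\<^sub>3))"
    by (rule weak_deriv_scaleR[OF d3 \<open>b \<noteq> 0\<close>])
  then have D': "D = (1 / b) *\<^sub>R (- V\<^sub>3 - N\<^sub>3)"
    by (rule weak_deriv_unique[OF D])
  have V\<^sub>1: "V\<^sub>1 = - (a *\<^sub>R D)"
    using \<open>a \<noteq> 0\<close> by (simp add: D_def)
  have V\<^sub>3: "V\<^sub>3 = - (b *\<^sub>R D) - N\<^sub>3"
    using \<open>b \<noteq> 0\<close> by (simp add: D')
  define Q where "Q = - V\<^sub>2 - N\<^sub>2"
  have V\<^sub>2: "V\<^sub>2 = - Q - N\<^sub>2"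
    by (simp add: Q_def)
  have Q: "weak_deriv Z Q"
    using d2 by (simp add: Q_def)
  note D_mean = weak_deriv_mean[OF D] and Q_mean = weak_deriv_mean[OF Q]
  show "torus_mean V\<^sub>1 = 0"
    using D_mean by (simp add: V\<^sub>1 torus_mean_def)
  have W_mean: "torus_mean W = 0"
    by (simp add: W_def torus_mean_diff torus_mean_const)
  have W_inner: "inner W F = inner U\<^sub>1 F" if "torus_mean F = 0" for F
    using that by (simp add: W_def inner_diff_left inner_commute[of "const_L2 _"] inner_const_L2)
  have skew: "inner D Z = - inner U\<^sub>2 Q"
    by (rule weak_deriv_skew[OF D Q])
  have e1: "inner W V\<^sub>1 = - (a * inner U\<^sub>1 D)"
    using W_inner[OF D_mean] by (simp add: V\<^sub>1)
  have DZ: "inner D Z = a * inner U\<^sub>1 D + b * inner U\<^sub>3 D"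
    by (simp add: Z_def inner_add_right inner_commute)
  have e123: "inner W V\<^sub>1 + inner U\<^sub>2 V\<^sub>2 + inner U\<^sub>3 V\<^sub>3 = - inner N\<^sub>2 U\<^sub>2 - inner N\<^sub>3 U\<^sub>3"
    using skew DZ unfolding e1 by (simp add: V\<^sub>2 V\<^sub>3 inner_diff_right inner_commute)
  \<comment> \<open>\<open>P D\<close> is \<open>U\<^sub>2\<close> minus its mean. This is the price
    of the cross term, reduced by a square of the mean whose sign is favourable.\<close>
  have "inner (antideriv_L2 D) U\<^sub>2 = inner U\<^sub>2 U\<^sub>2 - (torus_mean U\<^sub>2)\<^sup>2"
    by (simp add: antideriv_L2_weak_deriv[OF D] inner_diff_left inner_const_L2 power2_eq_square
        inner_commute[of "const_L2 _"])
  then have PV\<^sub>1: "inner (antideriv_L2 V\<^sub>1) U\<^sub>2 = - (a * (inner U\<^sub>2 U\<^sub>2 - (torus_mean U\<^sub>2)\<^sup>2))"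
    using antideriv_L2_scaleR[of "- a" D] by (simp add: V\<^sub>1)
  \<comment> \<open>Moving \<open>P\<close> onto \<open>Q\<close> recovers \<open>Z\<close> up to a
    constant, and the \<open>U\<^sub>1\<close> part of \<open>Z\<close> then produces
    \<open>a * inner W W\<close>, the damping of \<open>W\<close>.\<close>
  have "inner (antideriv_L2 W) Q = - inner W Z"
    using inner_antideriv_L2_skew[OF W_mean Q_mean] W_mean
    by (simp add: antideriv_L2_weak_deriv[OF Q] inner_diff_right inner_const_L2)
  moreover have "inner W U\<^sub>1 = inner W W"
    using W_mean by (simp add: W_def inner_diff_right inner_const_L2)
  ultimately have PW: "inner (antideriv_L2 W) V\<^sub>2 = a * inner W W + b * inner W U\<^sub>3 - inner N\<^sub>2 (antideriv_L2 W)"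
    by (simp add: V\<^sub>2 Z_def inner_diff_right inner_add_right inner_commute[of N\<^sub>2])
  have bound: "- 2 * inner N\<^sub>2 U\<^sub>2 - 2 * inner N\<^sub>3 U\<^sub>3 + (a * \<theta> + \<alpha>) * inner U\<^sub>2 U\<^sub>2 + \<alpha> * inner U\<^sub>3 U\<^sub>3
      - \<theta> * b * inner W U\<^sub>3 + \<theta> * inner N\<^sub>2 (antideriv_L2 W) - \<theta> * \<alpha> * inner (antideriv_L2 W) U\<^sub>2
    \<le> (a * \<theta> - \<alpha>) * inner W W"
    using form_bound[OF norm_antideriv_L2_le[OF W_mean], of U\<^sub>2 U\<^sub>3]
    by (simp add: a_def b_def N\<^sub>2_def N\<^sub>3_def)
  have "0 \<le> \<theta> * a * (torus_mean U\<^sub>2)\<^sup>2"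
    using \<theta> by (simp add: a_def)
  with bound e123 show "2 * inner W V\<^sub>1 + 2 * inner U\<^sub>2 V\<^sub>2 + 2 * inner U\<^sub>3 V\<^sub>3
      - \<theta> * (inner (antideriv_L2 V\<^sub>1) U\<^sub>2 + inner (antideriv_L2 W) V\<^sub>2)
      + \<alpha> * (inner W W + inner U\<^sub>2 U\<^sub>2 + inner U\<^sub>3 U\<^sub>3 - \<theta> * inner (antideriv_L2 W) U\<^sub>2) \<le> 0"
    unfolding PV\<^sub>1 PW by (simp add: algebra_simps)
qed

end

text \<open>The value \<open>- \<infinity>\<close> is excluded because the torus is not a null set:
  an almost-everywhere statement independent of \<open>x\<close> must hold outright.\<close>

lemma ess_sup_real:
  assumes "AE x in torus. 0 \<le> f x" "ess_sup f < \<infinity>"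
  obtains s where "ess_sup f = ereal s" "0 \<le> s" "AE x in torus. f x \<le> s"
proof -
  have le: "AE x in torus. ereal (f x) \<le> ess_sup f"
    unfolding ess_sup_def by (rule esssup_AE)
  with assms(1) have "AE x in torus. 0 \<le> ess_sup f"
  proof eventually_elim
    case (elim x)
    then show ?case
      using order_trans[of 0 "ereal (f x)" "ess_sup f"] by simp
  qed
  moreover have "ae_filter torus \<noteq> bot"
    by (simp add: ae_filter_eq_bot_iff emeasure_restrict_space)
  ultimately have "0 \<le> ess_sup f"
    by (simp add: eventually_const)
  with assms(2) obtain s where s: "ess_sup f = ereal s"
    by (cases "ess_sup f") auto
  with le \<open>0 \<le> ess_sup f\<close> that show thesis
    by simp
qed

lemma GT_energy_inner:
  "GT_energy \<theta> f g h = inner f f + inner g g + inner h h - \<theta> * inner (antideriv_L2 f) g"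
  by (simp add: GT_energy_def power2_norm_eq_inner flip: inner_antideriv_L2)

theorem theorem6p1:
  fixes \<sigma> :: "real \<Rightarrow> real"
    and u1 u2 u3 :: "real \<Rightarrow> torus_L2"
    and u10 u20 u30 :: torus_L2
    and u_inf \<theta> \<alpha> t :: real
  assumes "L_infinity \<sigma>"
    and "ess_inf \<sigma> > 0"
    and "continuous_on {0..} u1" "continuous_on {0..} u2" "continuous_on {0..} u3"
    and "mild_solution (GT_operator \<sigma>) (u10, u20, u30) (\<lambda>s. (u1 s, u2 s, u3 s))"
    and "u_inf = (1 / (2 * pi)) * (LINT x:{0..2 * pi}|lebesgue. rep_L2 u10 x)"
    and "\<theta> > 0" and "\<alpha> > 0"
    and "ereal (sqrt (2 / 3) * \<theta> + \<alpha>) < 2 * ess_inf \<sigma>"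
    and "\<alpha> \<le> sqrt (2 / 3) * \<theta>"
    and "ess_sup (\<lambda>x. \<theta>\<^sup>2 * (\<sigma> x - \<alpha>)\<^sup>2 / (8 * \<sigma> x - 4 * sqrt (2 / 3) * \<theta> - 4 * \<alpha>))
          + ess_sup (\<lambda>x. \<theta>\<^sup>2 / (12 * (2 * \<sigma> x - \<alpha>)))
         \<le> ereal (sqrt (2 / 3) * \<theta> - \<alpha>)"
    and "t \<ge> 0"
  shows "GT_energy \<theta> (u1 t - const_L2 u_inf) (u2 t) (u3 t)
         \<le> GT_energy \<theta> (u10 - const_L2 u_inf) u20 u30 * exp (- \<alpha> * t)"
proof -
  have meas: "\<sigma> \<in> borel_measurable torus" and fin: "ess_sup (\<lambda>x. \<bar>\<sigma> x\<bar>) < \<infinity>"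
    using assms(1) by (auto simp: L_infinity_def)
  obtain B where B: "AE x in torus. \<bar>\<sigma> x\<bar> \<le> B"
    using ess_sup_real[OF _ fin] by auto
  have lower: "AE x in torus. sqrt (2 / 3) * \<theta> + \<alpha> < 2 * \<sigma> x"
    using esssup_AE[of "\<lambda>x. - ereal (\<sigma> x)" torus]
  proof eventually_elim
    case (elim x)
    then have "ess_inf \<sigma> \<le> ereal (\<sigma> x)"
      unfolding ess_inf_def by (simp add: ereal_uminus_le_reorder)
    then have "2 * ess_inf \<sigma> \<le> 2 * ereal (\<sigma> x)"
      by (intro ereal_mult_left_mono) auto
    with assms(10) have "ereal (sqrt (2 / 3) * \<theta> + \<alpha>) < 2 * ereal (\<sigma> x)"
      by (rule less_le_trans)
    then show ?case
      by simp
  qed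
  define f\<^sub>1 f\<^sub>2 where "f\<^sub>1 x = \<theta>\<^sup>2 * (\<sigma> x - \<alpha>)\<^sup>2 / (8 * \<sigma> x - 4 * sqrt (2 / 3) * \<theta> - 4 * \<alpha>)"
    and "f\<^sub>2 x = \<theta>\<^sup>2 / (12 * (2 * \<sigma> x - \<alpha>))" for x
  have sum: "ess_sup f\<^sub>1 + ess_sup f\<^sub>2 \<le> ereal (sqrt (2 / 3) * \<theta> - \<alpha>)"
    using assms(12) by (simp add: f\<^sub>1_def[abs_def] f\<^sub>2_def[abs_def])
  have pos: "AE x in torus. 0 \<le> f\<^sub>1 x \<and> 0 \<le> f\<^sub>2 x"
    using lower
  proof eventually_elim
    case (elim x)
    have "0 < sqrt (2 / 3) * \<theta>"
      using assms(8) by simp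
    with elim have "0 < 8 * \<sigma> x - 4 * sqrt (2 / 3) * \<theta> - 4 * \<alpha>" "0 < 2 * \<sigma> x - \<alpha>"
      by simp_all
    then show ?case
      unfolding f\<^sub>1_def f\<^sub>2_def by (intro conjI divide_nonneg_pos) simp_all
  qed
  \<comment> \<open>In \<open>ereal\<close>, \<open>\<infinity>\<close> plus anything is
    \<open>\<infinity>\<close>, even when the other summand is \<open>- \<infinity>\<close>, so the
    bound on the sum keeps each term below \<open>\<infinity>\<close>.\<close>
  have "ess_sup f\<^sub>1 < \<infinity>" "ess_sup f\<^sub>2 < \<infinity>"
    using sum by (auto simp: less_top[symmetric])
  moreover have "AE x in torus. 0 \<le> f\<^sub>1 x" "AE x in torus. 0 \<le> f\<^sub>2 x"
    using pos by (auto elim: eventually_mono)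
  ultimately obtain S\<^sub>1 S\<^sub>2 where S: "ess_sup f\<^sub>1 = ereal S\<^sub>1" "0 \<le> S\<^sub>1" "AE x in torus. f\<^sub>1 x \<le> S\<^sub>1"
    "ess_sup f\<^sub>2 = ereal S\<^sub>2" "AE x in torus. f\<^sub>2 x \<le> S\<^sub>2"
    by (auto elim!: ess_sup_real)
  interpret GT_parameters \<sigma> \<theta> \<alpha> S\<^sub>1 S\<^sub>2 B
    using meas B assms(8) lower S sum by unfold_locales (simp_all add: f\<^sub>1_def f\<^sub>2_def)
  let ?u = "\<lambda>s. (u1 s, u2 s, u3 s)"
  have cont: "continuous_on {0..} ?u"
    by (intro continuous_on_Pair assms)
  have decay: "E (?u t) \<le> E (u10, u20, u30) * exp (- \<beta> * t)"
    if "\<And>x. (E has_derivative E' x) (at x)" "\<And>x y. (x, y) \<in> GT_operator \<sigma> \<Longrightarrow> E' x y + \<beta> * E x \<le> 0"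
    for E E' \<beta>
    by (rule mild_solution_Lyapunov[OF assms(6) cont assms(13) that])
  have mean: "torus_mean (u1 t) = torus_mean u10"
  proof -
    \<comment> \<open>Rate 0 decay of a linear functional, used for \<open>c = 1\<close> and
      \<open>c = - 1\<close>, gives conservation of the mean.\<close>
    have "c * torus_mean (u1 t) \<le> c * torus_mean u10" for c
    proof -
      have "((\<lambda>x. c * torus_mean (fst x)) has_derivative (\<lambda>x. c * torus_mean (fst x))) (at x)"
        for x :: "torus_L2 \<times> torus_L2 \<times> torus_L2"
        by (intro bounded_linear_imp_has_derivative bounded_linear_compose[OF bounded_linear_mult_right]
            bounded_linear_compose[OF bounded_linear_torus_mean] bounded_linear_fst)
      from decay[OF this, of 0] show ?thesis
        using dissipation(1) by (auto simp: split_paired_all)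
    qed
    from this[of 1] this[of "- 1"] show ?thesis
      by simp
  qed
  \<comment> \<open>Subtracting the state's own mean instead of the fixed \<open>u_inf\<close> makes
    \<open>W\<close> linear and \<open>E\<close> a quadratic form on the whole space. Conservation
    of the mean turns \<open>E\<close> back into \<open>GT_energy\<close> along the
    solution.\<close>
  define W :: "torus_L2 \<times> torus_L2 \<times> torus_L2 \<Rightarrow> torus_L2"
    where "W x = fst x - torus_mean (fst x) *\<^sub>R const_L2 1" for x
  have W: "W x = fst x - const_L2 (torus_mean (fst x))" for x
    by (simp add: W_def const_L2_scaleR[of "torus_mean (fst x)"])
  have W_lin: "bounded_linear W"
    unfolding W_def
    by (intro bounded_linear_sub bounded_linear_fst bounded_linear_compose[OF bounded_linear_scaleR_left]
        bounded_linear_compose[OF bounded_linear_torus_mean])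
  note PW_lin = bounded_linear_compose[OF bounded_linear_antideriv_L2 W_lin]
  note lin = bounded_linear.has_derivative[OF W_lin has_derivative_ident]
    bounded_linear.has_derivative[OF PW_lin has_derivative_ident]
  define E where "E x = inner (W x) (W x) + inner (fst (snd x)) (fst (snd x)) + inner (snd (snd x)) (snd (snd x))
    - \<theta> * inner (antideriv_L2 (W x)) (fst (snd x))" for x
  define E' where "E' x y = 2 * inner (W x) (W y) + 2 * inner (fst (snd x)) (fst (snd y))
    + 2 * inner (snd (snd x)) (snd (snd y))
    - \<theta> * (inner (antideriv_L2 (W y)) (fst (snd x)) + inner (antideriv_L2 (W x)) (fst (snd y)))" for x y
  have "E (?u t) \<le> E (u10, u20, u30) * exp (- \<alpha> * t)"
  proof (rule decay)
    show "(E has_derivative E' x) (at x)" for x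
      unfolding E_def E'_def
      by (auto intro!: derivative_eq_intros lin simp: fun_eq_iff inner_commute algebra_simps)
    \<comment> \<open>The derivative contains \<open>W y\<close>, while \<open>dissipation\<close>
      speaks of the first component of \<open>y\<close>; they agree because that component has mean
      0.\<close>
    fix x y assume "(x, y) \<in> GT_operator \<sigma>"
    then show "E' x y + \<alpha> * E x \<le> 0"
      using dissipation[of "fst x" "fst (snd x)" "snd (snd x)" "fst y" "fst (snd y)" "snd (snd y)"]
      by (simp add: E_def E'_def W const_L2_scaleR[of 0])
  qed
  moreover have "u_inf = torus_mean u10"
    unfolding assms(7) torus_mean_rep set_integral_torus ..
  ultimately show ?thesis
    by (simp add: E_def W GT_energy_inner mean)
qed

end
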